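(* For all integers $n\geq 0$, \[ M_{\omega}(1,5,5n+4)-M_{\omega}(4,5,5n+4)=2M_{\omega}(3,5,5n+4)-2M_{\omega}(2,5,5n+4). \]
   Context: For a partition $\pi$ of a positive integer $n$ (written $\pi\vdash n$), let $\lambda(\pi)$ be the largest part, $\omega(\pi)$ the number of parts equal to $1$, and $\mu(\pi)$ the number of parts larger than $\omega(\pi)$. The crank is $\mathrm{crank}(\pi)=\lambda(\pi)$ if $\omega(\pi)=0$ and $\mathrm{crank}(\pi)=\mu(\pi)-\omega(\pi)$ otherwise. For integers $m$, $j\ge1$, $n\ge0$: $M_{\omega}(m,j,n)=\sum_{\pi\vdash n,\ \mathrm{crank}(\pi)\equiv m\ (\mathrm{mod}\ j)}\omega(\pi)$. *)

theory Defs
  imports "HOL-Library.Multiset" "HOL-Number_Theory.Cong"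
begin

text \<open>A partition is the multiset of its parts, so parts are counted with multiplicity throughout.\<close>

definition partition_of :: "nat multiset \<Rightarrow> nat \<Rightarrow> bool"  (infix "\<turnstile>" 50)
  where "\<pi> \<turnstile> n \<longleftrightarrow> (\<forall>p \<in># \<pi>. 0 < p) \<and> sum_mset \<pi> = n"

text \<open>For the empty partition, the only partition of 0, the largest part (and hence the crank) is
  an unspecified value. It does not influence \<open>M_omega\<close>, because there the empty
  partition has weight 0.\<close>

definition largest_part :: "nat multiset \<Rightarrow> nat"
  where "largest_part \<pi> = Max (set_mset \<pi>)"

definition num_ones :: "nat multiset \<Rightarrow> nat"
  where "num_ones \<pi> = count \<pi> 1"

definition num_parts_above_ones :: "nat multiset \<Rightarrow> nat"
  where "num_parts_above_ones \<pi> = size {#p \<in># \<pi>. num_ones \<pi> < p#}"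

definition crank :: "nat multiset \<Rightarrow> int"
  where "crank \<pi> =
    (if num_ones \<pi> = 0 then int (largest_part \<pi>)
     else int (num_parts_above_ones \<pi>) - int (num_ones \<pi>))"

text \<open>Integer-valued, so that differences are not truncated.\<close>

definition M_omega :: "int \<Rightarrow> nat \<Rightarrow> nat \<Rightarrow> int"
  where "M_omega m j n = (\<Sum>\<pi> | \<pi> \<turnstile> n \<and> [crank \<pi> = m] (mod int j). int (num_ones \<pi>))"

text \<open>The sum in \<open>M_omega\<close> ranges over a finite set.\<close>

lemma finite_partitions: "finite {\<pi>. \<pi> \<turnstile> n}"
proof (rule finite_subset)
  show "{\<pi>. \<pi> \<turnstile> n} \<subseteq> mset ` {xs. set xs \<subseteq> {..n} \<and> length xs \<le> n}"
  proof
    fix \<pi> assume "\<pi> \<in> {\<pi>. \<pi> \<turnstile> n}"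
    then have pos: "\<forall>p \<in># \<pi>. 0 < p" and sum: "sum_mset \<pi> = n"
      by (auto simp: partition_of_def)
    have "size \<pi> \<le> sum_mset \<pi>"
      using pos by (induction \<pi>) auto
    moreover have "p \<le> sum_mset \<pi>" if "p \<in># \<pi>" for p
      using that by (auto dest: multi_member_split)
    moreover obtain xs where "\<pi> = mset xs"
      using ex_mset by metis
    ultimately show "\<pi> \<in> mset ` {xs. set xs \<subseteq> {..n} \<and> length xs \<le> n}"
      using sum by auto
  qed
  show "finite (mset ` {xs. set xs \<subseteq> {..n} \<and> length xs \<le> n})"
    by (intro finite_imageI finite_lists_length_le) simp
qed

end

theory Submission
  imports Defs "HOL-Computational_Algebra.Formal_Laurent_Series" "HOL-Library.Nat_Bijection"
begin

text \<open>Let $G(z)$ be the generating function of $\sum_\pi \omega(\pi) z^{\mathrm{crank}(\pi)}$ and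
  write $(c)$ for $\prod_{k \ge 1} (1 - c q^k)$. Sorting partitions by the number of ones and
  differentiating the $q$-binomial theorem gives
  $(z)(1/z)\,(G(z) - G(1/z)) = (1)\,(S(1/z) - S(z))$ with $S(c) = \sum_k c q^k / (1 - c q^k)$.
  The right-hand side contains the logarithmic derivative of $(z)(1/z)$, so that Jacobi's triple
  product and its derivative in $z$ turn all factors into theta series. If $z$ is a primitive fifth
  root of unity, multiplication by the square of $\prod_k (1 - q^{5k})$ yields
  $-\theta'(z)\,\theta(z^2)^2$, where $\theta(z) = (1)(z)(1/z)$ and $\theta'$ is its image under
  $-z\,d/dz$. Since triangular numbers are 0, 1 or 3 modulo 5, the coefficients at $5n + 4$ come
  from few terms, and those of $(z^3 - z^2)(G(z) - G(1/z))$ are $r_n (1 + z^2 + z^3)$ with $r_n$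
  independent of $z$. Comparing the two possible values of $z + 1/z$ yields the linear relation.
  All identities are between power series in $q$ truncated at a fixed order $N$.\<close>


subsection \<open>Congruence of power series up to a given order\<close>

definition eq_upto :: "nat \<Rightarrow> 'a :: comm_ring_1 fps \<Rightarrow> 'a fps \<Rightarrow> bool"
  where "eq_upto N f g \<longleftrightarrow> (\<forall>i\<le>N. fps_nth f i = fps_nth g i)"

lemma eq_upto_refl [simp]: "eq_upto N f f"
  by (simp add: eq_upto_def)

lemma eq_upto_sym: "eq_upto N f g \<Longrightarrow> eq_upto N g f"
  by (simp add: eq_upto_def)

lemma eq_upto_trans [trans]: "eq_upto N f g \<Longrightarrow> eq_upto N g h \<Longrightarrow> eq_upto N f h"
  by (simp add: eq_upto_def)

lemma eq_upto_mono: "eq_upto N f g \<Longrightarrow> M \<le> N \<Longrightarrow> eq_upto M f g"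
  by (simp add: eq_upto_def)

lemma eq_upto_add: "eq_upto N f g \<Longrightarrow> eq_upto N f' g' \<Longrightarrow> eq_upto N (f + f') (g + g')"
  by (simp add: eq_upto_def)

lemma eq_upto_diff: "eq_upto N f g \<Longrightarrow> eq_upto N f' g' \<Longrightarrow> eq_upto N (f - f') (g - g')"
  by (simp add: eq_upto_def)

lemma eq_upto_mult: "eq_upto N f g \<Longrightarrow> eq_upto N f' g' \<Longrightarrow> eq_upto N (f * f') (g * g')"
  unfolding eq_upto_def by (auto simp: fps_mult_nth intro!: sum.cong)

lemma eq_upto_sum: "(\<And>i. i \<in> A \<Longrightarrow> eq_upto N (f i) (g i)) \<Longrightarrow> eq_upto N (sum f A) (sum g A)"
  by (auto simp: eq_upto_def fps_sum_nth intro!: sum.cong)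

lemma eq_upto_X_power_mult:
  "eq_upto K f g \<Longrightarrow> eq_upto (K + t) (fps_X ^ t * f) (fps_X ^ t * g)"
  by (auto simp: eq_upto_def fps_X_power_mult_nth)

lemma eq_upto_multiple_0: "N < k \<Longrightarrow> eq_upto N (fps_X ^ k * f) 0"
  by (simp add: eq_upto_def fps_X_power_mult_nth)

text \<open>A series with nonzero constant term is a unit, and multiplying by its inverse preserves
  agreement up to order N.\<close>

lemma eq_upto_cancel:
  fixes f g h :: "'a :: field fps"
  assumes "eq_upto N (h * f) (h * g)" and "fps_nth h 0 \<noteq> 0"
  shows "eq_upto N f g"
proof -
  have "inverse h * (h * k) = k" for k
    using inverse_mult_eq_1[OF assms(2)] by (metis mult.assoc mult_1)
  then show ?thesis
    using eq_upto_mult[OF eq_upto_refl[of N "inverse h"] assms(1)] by (simp only:)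
qed

section \<open>Truncated q-Pochhammer products\<close>

definition qpoch :: "'a :: field \<Rightarrow> nat \<Rightarrow> 'a fps"
  where "qpoch c n = (\<Prod>k = 1..n. 1 - fps_const c * fps_X ^ k)"

lemma qpoch_0 [simp]: "qpoch c 0 = 1"
  by (simp add: qpoch_def)

lemma qpoch_Suc: "qpoch c (Suc n) = qpoch c n * (1 - fps_const c * fps_X ^ Suc n)"
  by (simp add: qpoch_def)

lemma qpoch_nth_0 [simp]: "fps_nth (qpoch c n) 0 = 1"
  by (induction n) (simp_all add: qpoch_Suc)

lemma qpoch_eq_upto:
  assumes "m \<le> n"
  shows "eq_upto m (qpoch c n) (qpoch c m)"
  using assms
proof (induction n rule: dec_induct)
  case (step n)
  have "eq_upto m (qpoch c n - fps_X ^ Suc n * (fps_const c * qpoch c n)) (qpoch c m - 0)"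
    using step by (intro eq_upto_diff eq_upto_multiple_0) auto
  then show ?case
    by (simp add: qpoch_Suc algebra_simps)
qed simp

subsection \<open>Generating functions of partitions\<close>

lemma finite_multisets_of_sum:
  assumes "0 \<notin> A"
  shows "finite {\<pi>. set_mset \<pi> \<subseteq> A \<and> sum_mset \<pi> = (n :: nat)}"
  using assms
  by (intro finite_subset[OF _ finite_partitions[of n]]) (auto simp: partition_of_def intro!: gr0I)

text \<open>Induction on the set of admissible part sizes: allowing a new size \<open>a\<close>
  multiplies the series by the geometric series of w(a) q^a, where q stands for
  \<open>fps_X\<close>. Written as a product equal to 1, the identity avoids dividing by the
  product.\<close>

lemma partition_generating_function:
  fixes w :: "nat \<Rightarrow> 'a :: field"
  assumes "finite A" and "0 \<notin> A"
  shows "(\<Prod>k\<in>A. 1 - fps_const (w k) * fps_X ^ k) *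
    Abs_fps (\<lambda>n. \<Sum>\<pi> | set_mset \<pi> \<subseteq> A \<and> sum_mset \<pi> = n. \<Prod>p\<in>#\<pi>. w p) = 1"
  using assms
proof (induction A)
  case empty
  have "{\<pi> :: nat multiset. set_mset \<pi> \<subseteq> {} \<and> sum_mset \<pi> = n} = (if n = 0 then {{#}} else {})" for n
    by auto
  then have "Abs_fps (\<lambda>n. \<Sum>\<pi> | set_mset \<pi> \<subseteq> {} \<and> sum_mset \<pi> = n. \<Prod>p\<in>#\<pi>. w p) = 1"
    by (intro fps_ext) simp
  then show ?case
    by simp
next
  case (insert a A)
  define P where "P B n = {\<pi>. set_mset \<pi> \<subseteq> B \<and> sum_mset \<pi> = (n :: nat)}" for B n
  define F where "F B = Abs_fps (\<lambda>n. \<Sum>\<pi>\<in>P B n. \<Prod>p\<in>#\<pi>. w p)" for B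
  have fin: "finite (P B n)" if "B \<subseteq> insert a A" for B n
    using that insert.prems unfolding P_def by (intro finite_multisets_of_sum) auto
  have step: "fps_nth (F (insert a A)) n =
      fps_nth (F A) n + (if n < a then 0 else w a * fps_nth (F (insert a A)) (n - a))" for n
  proof (cases "n < a")
    case True
    have "a \<notin># \<pi>" if "sum_mset \<pi> = n" for \<pi>
      using that True by (auto dest!: multi_member_split)
    then have "P (insert a A) n = P A n"
      by (auto simp: P_def)
    with True show ?thesis
      by (simp add: F_def)
  next
    case False
    \<comment> \<open>Only one copy of \<open>a\<close> is removed, so the remaining partition may
      still contain \<open>a\<close>. This yields a recurrence for the series over
      \<open>insert a A\<close> itself.\<close>
    have split: "P (insert a A) n = P A n \<union> add_mset a ` P (insert a A) (n - a)"
    proof (intro equalityI subsetI)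
      fix \<pi> assume \<pi>: "\<pi> \<in> P (insert a A) n"
      show "\<pi> \<in> P A n \<union> add_mset a ` P (insert a A) (n - a)"
      proof (cases "a \<in># \<pi>")
        case True
        then obtain \<sigma> where "\<pi> = add_mset a \<sigma>"
          by (auto dest!: multi_member_split)
        with \<pi> show ?thesis
          by (auto simp: P_def)
      next
        case False
        with \<pi> show ?thesis
          by (auto simp: P_def)
      qed
    next
      fix \<pi> assume "\<pi> \<in> P A n \<union> add_mset a ` P (insert a A) (n - a)"
      with False show "\<pi> \<in> P (insert a A) n"
        by (auto simp: P_def)
    qed
    have disj: "P A n \<inter> add_mset a ` P (insert a A) (n - a) = {}"
    proof -
      have "a \<notin># \<pi>" if "\<pi> \<in> P A n" for \<pi>
        using that \<open>a \<notin> A\<close> unfolding P_def by blast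
      then show ?thesis
        by fastforce
    qed
    have "(\<Sum>\<pi>\<in>P (insert a A) n. \<Prod>p\<in>#\<pi>. w p) = (\<Sum>\<pi>\<in>P A n. \<Prod>p\<in>#\<pi>. w p) +
        (\<Sum>\<pi>\<in>add_mset a ` P (insert a A) (n - a). \<Prod>p\<in>#\<pi>. w p)"
      unfolding split
      by (rule sum.union_disjoint[OF fin finite_imageI[OF fin] disj]) auto
    also have "(\<Sum>\<pi>\<in>add_mset a ` P (insert a A) (n - a). \<Prod>p\<in>#\<pi>. w p) =
        w a * (\<Sum>\<pi>\<in>P (insert a A) (n - a). \<Prod>p\<in>#\<pi>. w p)"
      by (subst sum.reindex) (simp_all add: inj_on_def sum_distrib_left)
    finally show ?thesis
      using False by (simp add: F_def)
  qed
  have "(1 - fps_const (w a) * fps_X ^ a) * F (insert a A) =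
      F (insert a A) - fps_const (w a) * (fps_X ^ a * F (insert a A))"
    by (simp add: algebra_simps)
  also have "\<dots> = F A"
    by (intro fps_ext) (use step in \<open>auto simp: fps_X_power_mult_nth\<close>)
  finally have "(1 - fps_const (w a) * fps_X ^ a) * F (insert a A) = F A" .
  then have "(\<Prod>k\<in>insert a A. 1 - fps_const (w k) * fps_X ^ k) * F (insert a A) =
      (\<Prod>k\<in>A. 1 - fps_const (w k) * fps_X ^ k) * F A"
    using insert.hyps by (simp add: mult.assoc mult.left_commute[of "_ - _"])
  also have "\<dots> = 1"
    using insert by (simp add: F_def P_def)
  finally show ?case
    by (simp add: F_def P_def)
qed

section \<open>The crank sum sorted by the number of ones\<close>

definition crank_sum :: "nat \<Rightarrow> 'a :: field \<Rightarrow> 'a"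
  where "crank_sum N z = (\<Sum>\<pi> | \<pi> \<turnstile> N. of_nat (num_ones \<pi>) * z powi crank \<pi>)"

text \<open>Removing the w ones leaves a partition of N - w into parts \<ge> 2. For w \<ge> 1 the
  crank is the number of parts above w minus w, so z to the crank is z^(-w) times one factor z for
  each part above w.\<close>

lemma crank_sum_by_ones:
  fixes z :: "'a :: field"
  assumes "z \<noteq> 0"
  shows "crank_sum N z = (\<Sum>w = 1..N. of_nat w * inverse z ^ w *
    (\<Sum>\<pi> | set_mset \<pi> \<subseteq> {2..N} \<and> sum_mset \<pi> = N - w. \<Prod>p\<in>#\<pi>. if w < p then z else 1))"
proof -
  define f where "f \<pi> = of_nat (num_ones \<pi>) * z powi crank \<pi>" for \<pi>
  have "num_ones \<pi> \<in> {0..N}" if "\<pi> \<turnstile> N" for \<pi>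
  proof -
    have "num_ones \<pi> \<le> size \<pi>"
      unfolding num_ones_def by (rule count_le_size)
    also have "size \<pi> \<le> sum_mset \<pi>"
      using that unfolding partition_of_def by (induction \<pi> arbitrary: N) auto
    finally show ?thesis
      using that by (simp add: partition_of_def)
  qed
  then have "crank_sum N z = (\<Sum>w\<in>{0..N}. \<Sum>\<pi> | \<pi> \<in> {\<pi>. \<pi> \<turnstile> N} \<and> num_ones \<pi> = w. f \<pi>)"
    unfolding crank_sum_def f_def[symmetric]
    by (intro sum.group[symmetric] finite_partitions) auto
  \<comment> \<open>The exceptional case w = 0, where the crank is the largest part, has weight
    zero.\<close>
  also have "\<dots> = (\<Sum>w = 1..N. \<Sum>\<pi> | \<pi> \<turnstile> N \<and> num_ones \<pi> = w. f \<pi>)"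
    by (simp, intro sum.mono_neutral_right) (auto simp: f_def not_less_eq_eq)
  also have "\<dots> = (\<Sum>w = 1..N. of_nat w * inverse z ^ w *
    (\<Sum>\<pi> | set_mset \<pi> \<subseteq> {2..N} \<and> sum_mset \<pi> = N - w. \<Prod>p\<in>#\<pi>. if w < p then z else 1))"
  proof (intro sum.cong refl)
    fix w assume w: "w \<in> {1..N}"
    let ?P = "{\<pi>. set_mset \<pi> \<subseteq> {2..N} \<and> sum_mset \<pi> = N - w}"
    let ?h = "\<lambda>\<pi>. \<pi> + replicate_mset w 1"
    have img: "{\<pi>. \<pi> \<turnstile> N \<and> num_ones \<pi> = w} = ?h ` ?P"
    proof (intro equalityI subsetI)
      fix \<pi> assume "\<pi> \<in> {\<pi>. \<pi> \<turnstile> N \<and> num_ones \<pi> = w}"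
      then have \<pi>: "\<forall>p\<in>#\<pi>. 0 < p" "sum_mset \<pi> = N" "count \<pi> 1 = w"
        by (auto simp: partition_of_def num_ones_def)
      define \<sigma> where "\<sigma> = filter_mset (\<lambda>p. p \<noteq> 1) \<pi>"
      have eq: "\<pi> = ?h \<sigma>"
        by (intro multiset_eqI) (use \<pi> in \<open>auto simp: \<sigma>_def\<close>)
      have le: "p \<le> N" if "p \<in># \<pi>" for p
        using that \<pi>(2) by (auto dest: multi_member_split)
      have "sum_mset \<pi> = sum_mset \<sigma> + w"
        by (subst eq) simp
      moreover have "p \<in> {2..N}" if "p \<in># \<sigma>" for p
      proof -
        have "p \<in># \<pi>" "p \<noteq> 1" "0 < p"
          using that \<pi> by (auto simp: \<sigma>_def)
        with le[of p] show ?thesis by auto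
      qed
      ultimately have "\<sigma> \<in> ?P"
        using \<pi> by auto
      with eq show "\<pi> \<in> ?h ` ?P"
        by blast
    next
      fix \<pi> assume "\<pi> \<in> ?h ` ?P"
      then obtain \<sigma> where \<sigma>: "set_mset \<sigma> \<subseteq> {2..N}" "sum_mset \<sigma> = N - w" "\<pi> = ?h \<sigma>"
        by blast
      then have "count \<sigma> 1 = 0"
        by (auto simp: count_eq_zero_iff)
      moreover have "0 < p" if "p \<in># \<pi>" for p
        using that \<sigma> by (fastforce split: if_splits)
      ultimately show "\<pi> \<in> {\<pi>. \<pi> \<turnstile> N \<and> num_ones \<pi> = w}"
        using \<sigma> w by (auto simp: partition_of_def num_ones_def)
    qed
    have val: "f (?h \<sigma>) = of_nat w * inverse z ^ w * (\<Prod>p\<in>#\<sigma>. if w < p then z else 1)"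
      if "\<sigma> \<in> ?P" for \<sigma>
    proof -
      have "count \<sigma> 1 = 0"
        using that by (auto simp: count_eq_zero_iff)
      then have ones: "num_ones (?h \<sigma>) = w"
        by (simp add: num_ones_def)
      \<comment> \<open>As w \<ge> 1, the ones themselves are never counted among the parts above
        w.\<close>
      have "filter_mset ((<) w) (replicate_mset w 1) = {#}"
        using w by (intro multiset_eqI) auto
      then have cr: "crank (?h \<sigma>) = int (size (filter_mset ((<) w) \<sigma>)) - int w"
        using w ones by (simp add: crank_def num_parts_above_ones_def)
      have "(\<Prod>p\<in>#\<sigma>. if w < p then z else 1) = z ^ size (filter_mset ((<) w) \<sigma>)"
        by (induction \<sigma>) auto
      then show ?thesis
        using assms unfolding f_def ones cr by (simp add: power_int_diff field_simps)
    qed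
    show "(\<Sum>\<pi> | \<pi> \<turnstile> N \<and> num_ones \<pi> = w. f \<pi>) = of_nat w * inverse z ^ w *
      (\<Sum>\<pi>\<in>?P. \<Prod>p\<in>#\<pi>. if w < p then z else 1)"
    proof -
      have "(\<Sum>\<pi>\<in>?h ` ?P. f \<pi>) = (\<Sum>\<sigma>\<in>?P. f (?h \<sigma>))"
        by (subst sum.reindex) (simp_all add: inj_on_def o_def)
      also have "\<dots> = (\<Sum>\<sigma>\<in>?P. of_nat w * inverse z ^ w * (\<Prod>p\<in>#\<sigma>. if w < p then z else 1))"
        by (intro sum.cong refl val)
      finally show ?thesis
        unfolding img sum_distrib_left .
    qed
  qed
  finally show ?thesis .
qed

text \<open>The products are truncated, so only the coefficients up to \<open>N\<close> have a combinatorial meaning.\<close>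

definition crank_gf :: "nat \<Rightarrow> 'a :: field \<Rightarrow> 'a fps"
  where "crank_gf N z = (1 - fps_X) * inverse (qpoch z N) * (\<Sum>w\<le>N. of_nat w *
    (qpoch z w * inverse (qpoch 1 w)) * (fps_const (inverse z) * fps_X) ^ w)"

lemma qpoch_inverse [simp]: "qpoch c n * inverse (qpoch c n) = 1"
  by (rule inverse_mult_eq_1') simp

text \<open>For fixed w, parts from 2 to w have weight 1 and parts from w + 1 to N have weight z.
  The inner sum is thus generated by (1 - q) \<open>qpoch z w\<close> / (\<open>qpoch 1 w\<close>
  \<open>qpoch z N\<close>), where 1 - q excludes the part 1.\<close>

lemma crank_gf_nth:
  fixes z :: "'a :: field"
  assumes "z \<noteq> 0"
  shows "fps_nth (crank_gf N z) N = crank_sum N z"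
proof -
  define F where "F w = Abs_fps (\<lambda>n. \<Sum>\<pi> | set_mset \<pi> \<subseteq> {2..N} \<and> sum_mset \<pi> = n.
    \<Prod>p\<in>#\<pi>. if w < p then z else 1)" for w
  have F: "F w = (1 - fps_X) * inverse (qpoch z N) * (qpoch z w * inverse (qpoch 1 w))"
    if w: "w \<in> {1..N}" for w
  proof -
    let ?t = "\<lambda>k. 1 - fps_const (if w < k then z else 1) * fps_X ^ k"
    have gf: "(\<Prod>k = 2..N. ?t k) * F w = 1"
      unfolding F_def by (rule partition_generating_function) auto
    have low: "(\<Prod>k = 1..w. ?t k) = qpoch 1 w"
      unfolding qpoch_def by (intro prod.cong) auto
    have "(\<Prod>k = w + 1..N. ?t k) = (\<Prod>k = w + 1..N. 1 - fps_const z * fps_X ^ k)"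
      by (intro prod.cong) auto
    then have high: "(\<Prod>k = w + 1..N. ?t k) * qpoch z w = qpoch z N"
      using w prod.ub_add_nat[of 1 w "\<lambda>k. 1 - fps_const z * fps_X ^ k" "N - w"]
      by (simp add: qpoch_def mult.commute)
    have split: "(\<Prod>k = 1..N. ?t k) = (\<Prod>k = 1..w. ?t k) * (\<Prod>k = w + 1..N. ?t k)"
      using w prod.ub_add_nat[of 1 w ?t "N - w"] by simp
    have "(\<Prod>k = 1..N. ?t k) = ?t 1 * (\<Prod>k = Suc 1..N. ?t k)"
      using w by (intro prod.atLeast_Suc_atMost) simp
    moreover have "?t 1 = 1 - fps_X"
      using w by simp
    ultimately have first: "(\<Prod>k = 1..N. ?t k) = (1 - fps_X) * (\<Prod>k = 2..N. ?t k)"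
      by (simp only: Suc_1)
    have "(1 - fps_X) * (\<Prod>k = 2..N. ?t k) * qpoch z w =
        (\<Prod>k = 1..w. ?t k) * ((\<Prod>k = w + 1..N. ?t k) * qpoch z w)"
      unfolding first[symmetric] split by (rule mult.assoc)
    also have "\<dots> = qpoch 1 w * qpoch z N"
      unfolding low high ..
    finally have "(1 - fps_X) * (\<Prod>k = 2..N. ?t k) * qpoch z w = qpoch 1 w * qpoch z N" .
    then have "qpoch 1 w * qpoch z N * F w = (1 - fps_X) * (\<Prod>k = 2..N. ?t k) * qpoch z w * F w"
      by simp
    also have "\<dots> = (1 - fps_X) * qpoch z w * ((\<Prod>k = 2..N. ?t k) * F w)"
      by (simp only: ac_simps)
    finally have "qpoch 1 w * qpoch z N * F w = (1 - fps_X) * qpoch z w"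
      unfolding gf by simp
    then have "inverse (qpoch z N) * (inverse (qpoch 1 w) * (qpoch 1 w * qpoch z N * F w)) =
        inverse (qpoch z N) * (inverse (qpoch 1 w) * ((1 - fps_X) * qpoch z w))"
      by simp
    moreover have "inverse (qpoch z N) * (inverse (qpoch 1 w) * (qpoch 1 w * qpoch z N * F w)) =
        (qpoch z N * inverse (qpoch z N)) * (qpoch 1 w * inverse (qpoch 1 w)) * F w"
      by (simp only: ac_simps)
    ultimately have "F w =
        inverse (qpoch z N) * (inverse (qpoch 1 w) * ((1 - fps_X) * qpoch z w))"
      by (simp only: qpoch_inverse mult_1)
    then show ?thesis
      by (simp only: ac_simps)
  qed
  have "crank_gf N z = (\<Sum>w = 1..N. of_nat w * (fps_const (inverse z) * fps_X) ^ w *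
      ((1 - fps_X) * inverse (qpoch z N) * (qpoch z w * inverse (qpoch 1 w))))"
    unfolding crank_gf_def sum_distrib_left
    by (intro sum.mono_neutral_cong_right) (auto simp: ac_simps not_less_eq_eq)
  also have "\<dots> = (\<Sum>w = 1..N. fps_const (of_nat w * inverse z ^ w) * (fps_X ^ w * F w))"
    by (intro sum.cong refl)
       (simp add: F power_mult_distrib fps_of_nat[symmetric] fps_const_power mult.assoc
          flip: fps_const_mult)
  finally have "crank_gf N z = \<dots>" .
  then show ?thesis
    by (auto simp: crank_sum_by_ones[OF assms] fps_sum_nth fps_X_power_mult_nth F_def
        intro!: sum.cong)
qed


subsection \<open>The crank generating function as a product\<close>

text \<open>Up to sign, this is the logarithmic derivative of \<open>qpoch c n\<close> under c
  d/dc.\<close>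

definition lambert :: "'a :: field \<Rightarrow> nat \<Rightarrow> 'a fps"
  where "lambert c n = (\<Sum>k = 1..n. fps_const c * fps_X ^ k * inverse (1 - fps_const c * fps_X ^ k))"

lemma inverse_one_minus_mult:
  assumes "0 < k"
  shows "(1 - fps_const (c :: 'a :: field) * fps_X ^ k) * inverse (1 - fps_const c * fps_X ^ k) = 1"
  by (rule inverse_mult_eq_1') (use assms in simp)

text \<open>The ratio of consecutive coefficients in the q-binomial theorem, cleared of
  denominators; it supplies the hypothesis \<open>rec\<close> of
  \<open>qbinomial_functional_equation\<close>.\<close>

lemma qbinomial_coeff_Suc:
  "(1 - fps_X ^ Suc w) * (qpoch z (Suc w) * inverse (qpoch 1 (Suc w))) =
    (1 - fps_const z * fps_X ^ Suc w) * (qpoch z w * inverse (qpoch 1 w))"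
proof -
  have "inverse (qpoch (1 :: 'a) (Suc w)) = inverse (qpoch 1 w) * inverse (1 - fps_X ^ Suc w)"
    by (simp add: qpoch_Suc fps_inverse_mult del: power_Suc)
  then show ?thesis
    using inverse_one_minus_mult[of "Suc w" "1 :: 'a"]
    by (simp add: qpoch_Suc ac_simps del: power_Suc)
qed

text \<open>Multiplying the $w$-th term by $1 - q^w$ turns the coefficient recurrence into the functional
  equations of \<open>\<Sum> c\<^sub>w t\<^sup>w\<close> and of its derivative under $t \mapsto qt$.\<close>

lemma qbinomial_functional_equation:
  fixes t y :: "'a :: comm_ring_1" and c :: "nat \<Rightarrow> 'a" and N :: nat
  assumes rec: "\<And>w. (1 - y ^ Suc w) * c (Suc w) = (1 - v * y ^ Suc w) * c w"
  defines "F \<equiv> \<lambda>t. \<Sum>w\<le>N. c w * t ^ w" and "H \<equiv> \<lambda>t. \<Sum>w\<le>N. of_nat w * c w * t ^ w"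
  shows "(1 - t) * F t = (1 - v * y * t) * F (y * t) - c N * (1 - v * y ^ Suc N) * t ^ Suc N"
    and "(1 - t) * H t - t * F t = (1 - v * y * t) * H (y * t) - v * y * t * F (y * t)
      - of_nat (Suc N) * c N * (1 - v * y ^ Suc N) * t ^ Suc N"
proof -
  \<comment> \<open>The multiplier g treats both equations at once: g = 1 gives the one for
    \<open>F\<close>, and \<open>g = of_nat\<close> the one for \<open>H\<close>.\<close>
  have main: "(\<Sum>w\<le>N. g w * c w * t ^ w) - (\<Sum>w\<le>N. g w * c w * (y * t) ^ w) =
      t * (\<Sum>w\<le>N. g (Suc w) * c w * t ^ w) - v * y * t * (\<Sum>w\<le>N. g (Suc w) * c w * (y * t) ^ w)
      - g (Suc N) * c N * (1 - v * y ^ Suc N) * t ^ Suc N" for g :: "nat \<Rightarrow> 'a"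
  proof -
    have "g w * c w * t ^ w - g w * c w * (y * t) ^ w = g w * ((1 - y ^ w) * c w) * t ^ w" for w
      by (simp add: algebra_simps power_mult_distrib)
    then have "(\<Sum>w\<le>N. g w * c w * t ^ w) - (\<Sum>w\<le>N. g w * c w * (y * t) ^ w) =
        (\<Sum>w\<le>N. g w * ((1 - y ^ w) * c w) * t ^ w)"
      by (simp add: sum_subtractf[symmetric])
    \<comment> \<open>The term w = 0 vanishes because 1 - y^0 = 0, so the index can be shifted and
      \<open>rec\<close> applied. Extending the shifted range to N then creates the boundary
      term.\<close>
    also have "\<dots> = (\<Sum>w<N. g (Suc w) * ((1 - v * y ^ Suc w) * c w) * t ^ Suc w)"
      by (subst sum.atMost_shift) (simp add: rec del: power_Suc)
    also have "\<dots> = (\<Sum>w\<le>N. g (Suc w) * ((1 - v * y ^ Suc w) * c w) * t ^ Suc w)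
        - g (Suc N) * c N * (1 - v * y ^ Suc N) * t ^ Suc N"
      by (simp add: lessThan_Suc_atMost[symmetric] algebra_simps del: power_Suc)
    also have "(\<Sum>w\<le>N. g (Suc w) * ((1 - v * y ^ Suc w) * c w) * t ^ Suc w) =
        t * (\<Sum>w\<le>N. g (Suc w) * c w * t ^ w) - v * y * t * (\<Sum>w\<le>N. g (Suc w) * c w * (y * t) ^ w)"
      by (simp add: sum_distrib_left sum_subtractf[symmetric] algebra_simps power_mult_distrib)
    finally show ?thesis .
  qed
  show "(1 - t) * F t = (1 - v * y * t) * F (y * t) - c N * (1 - v * y ^ Suc N) * t ^ Suc N"
    using main[of "\<lambda>_. 1"] unfolding F_def by (simp add: algebra_simps)
  have sum_H: "(\<Sum>w\<le>N. of_nat w * c w * s ^ w) = H s" for s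
    unfolding H_def ..
  have split: "(\<Sum>w\<le>N. of_nat (Suc w) * c w * s ^ w) = H s + F s" for s
    unfolding F_def H_def by (simp add: algebra_simps sum.distrib)
  show "(1 - t) * H t - t * F t = (1 - v * y * t) * H (y * t) - v * y * t * F (y * t)
      - of_nat (Suc N) * c N * (1 - v * y ^ Suc N) * t ^ Suc N"
    using main[of of_nat] unfolding split unfolding sum_H by (simp only: algebra_simps mult_1)
qed

text \<open>The series in \<open>crank_gf\<close> is t d/dt of the q-binomial series at t = q / z.
  The functional equations move t to q^(N+1) / z, where both series are trivial up to order N; along
  the way they produce the product for \<open>F\<close> and the sum of logarithmic derivatives for
  \<open>H\<close>.\<close>

lemma crank_gf_product:
  fixes z :: "'a :: field"
  assumes "z \<noteq> 0"
  shows "eq_upto N (qpoch z N * qpoch (inverse z) N * crank_gf N z)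
    (qpoch 1 N * (lambert (inverse z) N -
      (\<Sum>k = 1..N. fps_X ^ Suc k * inverse (1 - fps_X ^ Suc k))))"
proof -
  define x where "x = inverse z"
  define c where "c w = qpoch z w * inverse (qpoch 1 w)" for w
  define t where "t k = fps_const x * fps_X ^ k" for k
  \<comment> \<open>\<open>F k\<close> and \<open>H k\<close> are the q-binomial series and its
    image under t d/dt at t = q^k / z; \<open>R k\<close> will be their quotient up to order
    N.\<close>
  define F where "F k = (\<Sum>w\<le>N. c w * t k ^ w)" for k
  define H where "H k = (\<Sum>w\<le>N. of_nat w * c w * t k ^ w)" for k
  define R where "R k = (\<Sum>j = k..N. t j * inverse (1 - t j) -
    fps_X ^ Suc j * inverse (1 - fps_X ^ Suc j))" for k
  have zx: "fps_const z * fps_const x = 1"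
    using assms by (simp add: x_def)
  have zt: "fps_const z * fps_X * t k = fps_X ^ Suc k" for k
    using zx by (simp add: t_def ac_simps)
  have tS: "fps_X * t k = t (Suc k)" for k
    by (simp add: t_def ac_simps)
  have c_rec: "(1 - fps_X ^ Suc w) * c (Suc w) = (1 - fps_const z * fps_X ^ Suc w) * c w" for w
    unfolding c_def by (rule qbinomial_coeff_Suc)
  note fe = qbinomial_functional_equation[where y = fps_X and v = "fps_const z" and c = c and N = N,
      OF c_rec]
  have small: "eq_upto N (a * t k ^ Suc N) 0" if "0 < k" for a k
  proof -
    have "a * t k ^ Suc N = fps_X ^ (k * Suc N) * (a * fps_const x ^ Suc N)"
      by (simp only: t_def power_mult_distrib power_mult) (simp only: ac_simps)
    moreover have "N < k * Suc N"
      using that by (cases k) auto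
    ultimately show ?thesis
      by (simp only: eq_upto_multiple_0)
  qed
  have FS: "eq_upto N ((1 - t k) * F k) ((1 - fps_X ^ Suc k) * F (Suc k))" if "0 < k" for k
  proof -
    have "(1 - t k) * F k = (1 - fps_X ^ Suc k) * F (Suc k)
        - c N * (1 - fps_const z * fps_X ^ Suc N) * t k ^ Suc N"
      using fe(1)[of "t k"] unfolding zt tS F_def .
    then show ?thesis
      using eq_upto_diff[OF eq_upto_refl small[OF that]] by (metis diff_zero)
  qed
  have HS: "eq_upto N ((1 - t k) * H k - t k * F k)
      ((1 - fps_X ^ Suc k) * H (Suc k) - fps_X ^ Suc k * F (Suc k))" if "0 < k" for k
  proof -
    have "(1 - t k) * H k - t k * F k = (1 - fps_X ^ Suc k) * H (Suc k) - fps_X ^ Suc k * F (Suc k)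
        - of_nat (Suc N) * c N * (1 - fps_const z * fps_X ^ Suc N) * t k ^ Suc N"
      using fe(2)[of "t k"] unfolding zt tS F_def H_def .
    then show ?thesis
      using eq_upto_diff[OF eq_upto_refl small[OF that]] by (metis diff_zero)
  qed
  \<comment> \<open>At k = N + 1 every positive power of \<open>t k\<close> lies beyond order N.
    Only the term w = 0 survives, which is 1 in \<open>F\<close> and 0 in \<open>H\<close>.\<close>
  have t_last: "eq_upto N (a * t (Suc N) ^ w) 0" if "0 < w" for a w
  proof -
    have "a * t (Suc N) ^ w = fps_X ^ (Suc N * w) * (a * fps_const x ^ w)"
      by (simp only: t_def power_mult_distrib power_mult) (simp only: ac_simps)
    moreover have "N < Suc N * w"
      using that by (cases w) auto
    ultimately show ?thesis
      by (simp only: eq_upto_multiple_0)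
  qed
  have F_last: "eq_upto N (F (Suc N)) 1"
  proof -
    have "eq_upto N (F (Suc N)) (\<Sum>w\<le>N. if w = 0 then 1 else 0)"
      unfolding F_def by (intro eq_upto_sum) (auto simp: c_def intro: t_last)
    then show ?thesis by simp
  qed
  have H_last: "eq_upto N (H (Suc N)) 0"
  proof -
    have "eq_upto N (H (Suc N)) (\<Sum>w\<le>N. 0)"
      unfolding H_def
    proof (intro eq_upto_sum)
      fix w
      show "eq_upto N (of_nat w * c w * t (Suc N) ^ w) 0"
        by (cases "w = 0") (auto intro: t_last)
    qed
    then show ?thesis by simp
  qed
  have t_inv: "(1 - t k) * inverse (1 - t k) = 1" if "0 < k" for k
    unfolding t_def by (rule inverse_one_minus_mult[OF that])
  have X_inv: "(1 - fps_X ^ Suc k) * inverse (1 - fps_X ^ Suc k :: 'a fps) = 1" for k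
    using inverse_one_minus_mult[of "Suc k" "1 :: 'a"] by simp
  \<comment> \<open>Downward induction from N + 1: dividing the equation for \<open>H\<close> by the
    one for \<open>F\<close> adds the two summands with index k to the quotient.\<close>
  have log_deriv: "eq_upto N (H k) (F k * R k)" if "0 < k" "k \<le> Suc N" for k
    using that(2,1)
  proof (induction k rule: inc_induct)
    case base
    then show ?case
      using H_last by (simp add: R_def)
  next
    case (step k)
    define a where "a = 1 - t k"
    define y where "y = (fps_X ^ Suc k :: 'a fps)"
    define b where "b = 1 - y"
    define ai where "ai = inverse a"
    define bi where "bi = inverse b"
    have R: "R k = t k * ai - y * bi + R (Suc k)"
      using step unfolding R_def a_def b_def ai_def bi_def y_def
      by (subst sum.atLeast_Suc_atMost) auto
    have ai: "a * ai = 1"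
      unfolding a_def ai_def using step by (intro t_inv)
    have bi: "b * bi = 1"
      unfolding b_def bi_def y_def by (rule X_inv)
    have Fk: "eq_upto N (b * F (Suc k)) (a * F k)"
      unfolding a_def b_def y_def using step by (intro eq_upto_sym[OF FS])
    have "a * H k = (a * H k - t k * F k) + t k * F k"
      by simp
    also have "eq_upto N \<dots> (b * H (Suc k) - y * F (Suc k) + t k * F k)"
      unfolding a_def b_def y_def using step by (intro eq_upto_add HS eq_upto_refl)
    also have "eq_upto N \<dots> (b * (F (Suc k) * R (Suc k)) - y * F (Suc k) + t k * F k)"
      using step by (intro eq_upto_add eq_upto_diff eq_upto_mult eq_upto_refl step.IH) auto
    also have "b * (F (Suc k) * R (Suc k)) - y * F (Suc k) + t k * F k =
        b * F (Suc k) * R (Suc k) - y * bi * (b * F (Suc k)) + t k * F k"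
      using bi by algebra
    also have "eq_upto N \<dots> (a * F k * R (Suc k) - y * bi * (a * F k) + t k * F k)"
      by (intro eq_upto_add eq_upto_diff eq_upto_mult eq_upto_refl Fk)
    also have "\<dots> = a * (F k * R k)"
      unfolding R using ai by algebra
    finally show ?case
      by (rule eq_upto_cancel) (use step in \<open>simp add: a_def t_def\<close>)
  qed
  \<comment> \<open>Iterating the functional equation gives the product side of the q-binomial
    theorem. The factor 1 - q of \<open>crank_gf\<close> provides the first factor of
    \<open>qpoch 1 (Suc k)\<close>.\<close>
  have F_prod: "eq_upto N ((1 - fps_X) * qpoch x k * F 1) (qpoch 1 (Suc k) * F (Suc k))" for k
  proof (induction k)
    case 0
    then show ?case
      by (simp add: qpoch_Suc)
  next
    case (Suc k)
    have "(1 - fps_X) * qpoch x (Suc k) * F 1 = (1 - t (Suc k)) * ((1 - fps_X) * qpoch x k * F 1)"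
      by (simp only: qpoch_Suc t_def ac_simps)
    also have "eq_upto N \<dots> ((1 - t (Suc k)) * (qpoch 1 (Suc k) * F (Suc k)))"
      by (intro eq_upto_mult eq_upto_refl Suc.IH)
    also have "\<dots> = qpoch 1 (Suc k) * ((1 - t (Suc k)) * F (Suc k))"
      by (simp only: ac_simps)
    also have "eq_upto N \<dots> (qpoch 1 (Suc k) * ((1 - fps_X ^ Suc (Suc k)) * F (Suc (Suc k))))"
      by (intro eq_upto_mult eq_upto_refl FS) simp
    also have "\<dots> = qpoch 1 (Suc (Suc k)) * F (Suc (Suc k))"
      by (simp add: qpoch_Suc[of _ "Suc k"] mult.assoc del: power_Suc)
    finally show ?case .
  qed
  have "qpoch z N * qpoch x N * crank_gf N z =
      (qpoch z N * inverse (qpoch z N)) * ((1 - fps_X) * qpoch x N * H 1)"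
    by (simp only: crank_gf_def x_def[symmetric] H_def c_def t_def power_one_right ac_simps)
  also have "\<dots> = (1 - fps_X) * qpoch x N * H 1"
    by simp
  also have "eq_upto N \<dots> ((1 - fps_X) * qpoch x N * (F 1 * R 1))"
    by (intro eq_upto_mult eq_upto_refl log_deriv) auto
  also have "\<dots> = (1 - fps_X) * qpoch x N * F 1 * R 1"
    by (simp only: ac_simps)
  also have "eq_upto N \<dots> (qpoch 1 (Suc N) * F (Suc N) * R 1)"
    by (intro eq_upto_mult eq_upto_refl F_prod)
  also have "eq_upto N \<dots> (qpoch 1 N * 1 * R 1)"
    by (intro eq_upto_mult eq_upto_refl F_last qpoch_eq_upto) simp
  also have "R 1 = lambert x N - (\<Sum>k = 1..N. fps_X ^ Suc k * inverse (1 - fps_X ^ Suc k))"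
    unfolding R_def lambert_def t_def sum_subtractf ..
  finally show ?thesis
    by (simp add: x_def)
qed

text \<open>The prefactor in \<open>crank_gf_product\<close> is symmetric in z and 1/z, and the
  second sum there is free of z, so that sum cancels in the difference.\<close>

lemma crank_gf_diff:
  fixes z x :: "'a :: field"
  assumes "z * x = 1"
  shows "eq_upto N (qpoch z N * qpoch x N * (crank_gf N z - crank_gf N x))
    (qpoch 1 N * (lambert x N - lambert z N))"
proof -
  have "z \<noteq> 0" "x \<noteq> 0" "inverse z = x" "inverse x = z"
    using assms inverse_unique[of z x] inverse_unique[of x z] by (auto simp: mult.commute)
  then show ?thesis
    using eq_upto_diff[OF crank_gf_product[of z N] crank_gf_product[of x N]]
    by (simp add: algebra_simps)
qed


subsection \<open>A finite form of Jacobi's triple product\<close>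

text \<open>For x = 1/z this is the sum of z^k over -n \<le> k \<le> n, the coefficient in Jacobi's
  triple product after division by 1 - z. Carrying x separately makes the identities polynomial
  modulo z * x = 1.\<close>

definition chi :: "'a :: field \<Rightarrow> 'a \<Rightarrow> nat \<Rightarrow> 'a"
  where "chi z x n = 1 + (\<Sum>k = 1..n. z ^ k + x ^ k)"

text \<open>The image of \<open>chi z (1 / z) n\<close> under $-z\,d/dz$.\<close>

definition chi_deriv :: "'a :: field \<Rightarrow> 'a \<Rightarrow> nat \<Rightarrow> 'a"
  where "chi_deriv z x n = (\<Sum>k = 1..n. of_nat k * (x ^ k - z ^ k))"

text \<open>The case $n = 0$ is the reflection rule for the index $-1$, namely $v_{-1} = -v_0$.\<close>

definition reflected_pred :: "(nat \<Rightarrow> 'a :: ab_group_add) \<Rightarrow> nat \<Rightarrow> 'a"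
  where "reflected_pred v n = (if n = 0 then - v 0 else v (n - 1))"

lemma chi_simps [simp]:
  "chi z x 0 = 1" "chi z x (Suc n) = chi z x n + (z ^ Suc n + x ^ Suc n)"
  by (simp_all add: chi_def)

lemma chi_deriv_simps [simp]:
  "chi_deriv z x 0 = 0"
  "chi_deriv z x (Suc n) = chi_deriv z x n + of_nat (Suc n) * (x ^ Suc n - z ^ Suc n)"
  by (simp_all add: chi_deriv_def)

lemma chi_reflected_pred: "chi z x n = reflected_pred (chi z x) n + (z ^ n + x ^ n)"
  by (cases n) (simp_all add: reflected_pred_def)

lemma chi_deriv_reflected_pred:
  "chi_deriv z x n = reflected_pred (chi_deriv z x) n + of_nat n * (x ^ n - z ^ n)"
  by (cases n) (simp_all add: reflected_pred_def)

text \<open>Multiplying the symmetric sum by z + 1/z adds its two shifts, which regroup into the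
  sums of lengths n - 1 and n + 1.\<close>

lemma chi_recurrence:
  assumes "z * x = 1"
  shows "(z + x) * chi z x n = reflected_pred (chi z x) n + chi z x (Suc n)"
proof (induction n)
  case 0
  then show ?case
    by (simp add: reflected_pred_def)
next
  case (Suc n)
  have "(z + x) * chi z x (Suc n) = (z + x) * chi z x n + (z + x) * (z ^ Suc n + x ^ Suc n)"
    by (simp only: chi_simps distrib_left)
  also have "(z + x) * (z ^ Suc n + x ^ Suc n) =
      z ^ Suc (Suc n) + x ^ Suc (Suc n) + (z * x) * (z ^ n + x ^ n)"
    by (simp add: algebra_simps)
  also have "(z + x) * chi z x n + \<dots> = (reflected_pred (chi z x) n + (z ^ n + x ^ n)) +
      (chi z x (Suc n) + (z ^ Suc (Suc n) + x ^ Suc (Suc n)))"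
    unfolding Suc.IH assms by (simp del: chi_simps)
  also have "\<dots> = chi z x n + chi z x (Suc (Suc n))"
    unfolding chi_reflected_pred[symmetric] chi_simps(2)[of z x "Suc n"] ..
  also have "chi z x n = reflected_pred (chi z x) (Suc n)"
    by (simp add: reflected_pred_def)
  finally show ?case .
qed

text \<open>This is \<open>chi_recurrence\<close> under -z d/dz; the last term comes from
  differentiating z + 1/z.\<close>

lemma chi_deriv_recurrence:
  assumes "z * x = 1"
  shows "(z + x) * chi_deriv z x n =
    reflected_pred (chi_deriv z x) n + chi_deriv z x (Suc n) + (z - x) * chi z x n"
proof (induction n)
  case 0
  then show ?case
    by (simp add: reflected_pred_def algebra_simps)
next
  case (Suc n)
  define u where "u = chi_deriv z x n"
  define p where "p = reflected_pred (chi_deriv z x) n"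
  define k where "k = (of_nat n :: 'a)"
  define zn where "zn = z ^ n"
  define xn where "xn = x ^ n"
  define c where "c = chi z x n"
  note defs = u_def p_def k_def zn_def xn_def c_def
  have u: "u = p + k * (xn - zn)"
    unfolding defs by (rule chi_deriv_reflected_pred)
  have IH: "(z + x) * u = p + (u + (1 + k) * (x * xn - z * zn)) + (z - x) * c"
    using Suc.IH by (simp add: defs)
  have "(z + x) * (u + (1 + k) * (x * xn - z * zn)) =
      u + (u + (1 + k) * (x * xn - z * zn) + (2 + k) * (x * (x * xn) - z * (z * zn)))
      + (z - x) * (c + (z * zn + x * xn))"
    using IH u assms by algebra
  then show ?case
    by (simp add: defs reflected_pred_def add.assoc[symmetric])
qed

text \<open>The recursion comes from multiplying the product of order $N$ by
  $(1 - z q^{N+1})(1 - q^{N+1}/z) = 1 + q^{2(N+1)} - (z + 1/z)\, q^{N+1}$.\<close>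

primrec jtp_coeff :: "nat \<Rightarrow> nat \<Rightarrow> 'a :: field fps" where
  "jtp_coeff 0 = (\<lambda>n. if n = 0 then 1 else 0)"
| "jtp_coeff (Suc N) = (\<lambda>n. (1 + fps_X ^ Suc N * fps_X ^ Suc N) * jtp_coeff N n
    - fps_X ^ Suc N * (reflected_pred (jtp_coeff N) n + jtp_coeff N (Suc n)))"

lemma jtp_coeff_eq_0: "N < n \<Longrightarrow> jtp_coeff N n = 0"
  by (induction N arbitrary: n) (auto simp: reflected_pred_def)

text \<open>Summation by parts moves the index shifts from the coefficients to \<open>v\<close>. The
  reflection rule makes the two boundary terms \<open>e 0 * v 0\<close> occur with opposite signs,
  so they cancel.\<close>

lemma jtp_coeff_sum_Suc:
  "(\<Sum>n\<le>Suc N. jtp_coeff (Suc N) n * v n) =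
    (1 + fps_X ^ Suc N * fps_X ^ Suc N) * (\<Sum>n\<le>N. jtp_coeff N n * v n)
    - fps_X ^ Suc N * (\<Sum>n\<le>N. jtp_coeff N n * (reflected_pred v n + v (Suc n)))"
proof -
  define e where "e = (jtp_coeff N :: nat \<Rightarrow> 'a fps)"
  have e0: "e n = 0" if "N < n" for n
    unfolding e_def by (rule jtp_coeff_eq_0[OF that])
  have 1: "(\<Sum>n\<le>Suc N. e n * v n) = (\<Sum>n\<le>N. e n * v n)"
    by (simp add: e0)
  have "(\<Sum>n\<le>Suc N. e (Suc n) * v n) = (\<Sum>n\<le>Suc (Suc N). e n * reflected_pred v n) + e 0 * v 0"
    by (subst (2) sum.atMost_Suc_shift) (simp add: reflected_pred_def del: sum.atMost_Suc)
  also have "(\<Sum>n\<le>Suc (Suc N). e n * reflected_pred v n) = (\<Sum>n\<le>N. e n * reflected_pred v n)"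
    by (simp add: e0)
  finally have 2: "(\<Sum>n\<le>Suc N. e (Suc n) * v n) = (\<Sum>n\<le>N. e n * reflected_pred v n) + e 0 * v 0" .
  have 3: "(\<Sum>n\<le>Suc N. reflected_pred e n * v n) = (\<Sum>n\<le>N. e n * v (Suc n)) - e 0 * v 0"
    by (subst sum.atMost_Suc_shift) (simp add: reflected_pred_def)
  have "(\<Sum>n\<le>Suc N. jtp_coeff (Suc N) n * v n) =
      (1 + fps_X ^ Suc N * fps_X ^ Suc N) * (\<Sum>n\<le>Suc N. e n * v n) -
      fps_X ^ Suc N * ((\<Sum>n\<le>Suc N. reflected_pred e n * v n) + (\<Sum>n\<le>Suc N. e (Suc n) * v n))"
    unfolding jtp_coeff.simps e_def[symmetric] sum_distrib_left sum.distrib[symmetric]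
      sum_subtractf[symmetric]
    by (intro sum.cong refl) (simp only: algebra_simps)
  also have "\<dots> = (1 + fps_X ^ Suc N * fps_X ^ Suc N) * (\<Sum>n\<le>N. e n * v n) -
      fps_X ^ Suc N * (\<Sum>n\<le>N. e n * (reflected_pred v n + v (Suc n)))"
    unfolding 1 2 3 by (simp add: distrib_left sum.distrib)
  finally show ?thesis
    unfolding e_def .
qed

lemma fps_const_reflected_pred:
  "reflected_pred (\<lambda>n. fps_const (v n)) n = fps_const (reflected_pred v n)"
  by (simp add: reflected_pred_def)

text \<open>Both sides obey the same recursion in N, since \<open>chi_recurrence\<close> turns the
  two shifts into multiplication by z + x.\<close>

lemma finite_triple_product:
  fixes z x :: "'a :: field"
  assumes "z * x = 1"
  shows "qpoch z N * qpoch x N = (\<Sum>n\<le>N. jtp_coeff N n * fps_const (chi z x n))"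
proof (induction N)
  case (Suc N)
  define Q where "Q = (fps_X ^ Suc N :: 'a fps)"
  have zx: "fps_const z * fps_const x = 1"
    by (simp add: assms)
  have "(\<Sum>n\<le>Suc N. jtp_coeff (Suc N) n * fps_const (chi z x n)) =
      (1 + Q * Q) * (\<Sum>n\<le>N. jtp_coeff N n * fps_const (chi z x n)) -
      Q * (\<Sum>n\<le>N. jtp_coeff N n * fps_const ((z + x) * chi z x n))"
    unfolding jtp_coeff_sum_Suc fps_const_reflected_pred chi_recurrence[OF assms] Q_def by simp
  also have "(\<Sum>n\<le>N. jtp_coeff N n * fps_const ((z + x) * chi z x n)) =
      (fps_const z + fps_const x) * (\<Sum>n\<le>N. jtp_coeff N n * fps_const (chi z x n))"
    unfolding sum_distrib_left
    by (intro sum.cong refl) (simp add: mult.left_commute flip: fps_const_mult)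
  also have "(1 + Q * Q) * (\<Sum>n\<le>N. jtp_coeff N n * fps_const (chi z x n)) - Q * \<dots> =
      (1 + Q * Q - Q * (fps_const z + fps_const x)) * (qpoch z N * qpoch x N)"
    unfolding Suc.IH by (simp only: algebra_simps)
  also have "\<dots> = qpoch z (Suc N) * qpoch x (Suc N)"
    unfolding qpoch_Suc Q_def[symmetric] using zx by algebra
  finally show ?case ..
qed simp

text \<open>This is \<open>finite_triple_product\<close> under -z d/dz, with the left side written
  as product times logarithmic derivative. Instead of differentiating, the proof repeats the
  induction with \<open>chi_deriv_recurrence\<close>.\<close>

lemma finite_triple_product_deriv:
  fixes z x :: "'a :: field"
  assumes "z * x = 1"
  shows "qpoch z N * qpoch x N * (lambert z N - lambert x N) =
    (\<Sum>n\<le>N. jtp_coeff N n * fps_const (chi_deriv z x n))"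
proof (induction N)
  case 0
  then show ?case
    by (simp add: lambert_def)
next
  case (Suc N)
  define Q where "Q = (fps_X ^ Suc N :: 'a fps)"
  define S where "S v = (\<Sum>n\<le>N. jtp_coeff N n * fps_const (v n))" for v :: "nat \<Rightarrow> 'a"
  define l where "l c = inverse (1 - fps_const c * Q)" for c
  have l: "(1 - fps_const c * Q) * l c = 1" for c
    unfolding l_def Q_def by (rule inverse_one_minus_mult) simp
  have zx: "fps_const z * fps_const x = 1"
    by (simp add: assms)
  have prod: "qpoch z N * qpoch x N = S (chi z x)"
    unfolding S_def by (rule finite_triple_product[OF assms])
  have IH: "qpoch z N * qpoch x N * (lambert z N - lambert x N) = S (chi_deriv z x)"
    unfolding S_def by (rule Suc.IH)
  have lam: "lambert c (Suc N) = lambert c N + fps_const c * Q * l c" for c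
    by (simp add: lambert_def l_def Q_def)
  have lin: "S (\<lambda>n. (z + x) * chi_deriv z x n - (z - x) * chi z x n) =
      (fps_const z + fps_const x) * S (chi_deriv z x) - (fps_const z - fps_const x) * S (chi z x)"
    unfolding S_def sum_distrib_left sum_subtractf[symmetric]
    by (intro sum.cong refl)
       (simp add: algebra_simps flip: fps_const_mult fps_const_add fps_const_sub)
  have "(\<Sum>n\<le>Suc N. jtp_coeff (Suc N) n * fps_const (chi_deriv z x n)) =
      (1 + Q * Q) * S (chi_deriv z x) -
      Q * S (\<lambda>n. (z + x) * chi_deriv z x n - (z - x) * chi z x n)"
    unfolding jtp_coeff_sum_Suc fps_const_reflected_pred chi_deriv_recurrence[OF assms] S_def Q_def
    by simp
  also have "\<dots> = (1 + Q * Q) * S (chi_deriv z x) - Q * ((fps_const z + fps_const x) *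
      S (chi_deriv z x) - (fps_const z - fps_const x) * S (chi z x))"
    unfolding lin ..
  also have "\<dots> = qpoch z (Suc N) * qpoch x (Suc N) * (lambert z (Suc N) - lambert x (Suc N))"
    unfolding qpoch_Suc lam IH[symmetric] prod[symmetric] Q_def[symmetric]
    using l[of z] l[of x] zx by algebra
  finally show ?case ..
qed

lemma qpoch_1_Suc: "qpoch (1 :: 'a :: field) (Suc n) = qpoch 1 n * (1 - fps_X ^ Suc n)"
  by (simp add: qpoch_Suc del: power_Suc)

text \<open>Without denominators, the coefficient is (-1)^n q^(n(n+1)/2) times the q-binomial
  coefficient of 2N + 1 over N - n. The induction multiplies the recursion by the common denominator
  \<open>h\<close> and expresses all three neighbours through the single product
  \<open>M\<close>.\<close>

lemma jtp_coeff_closed_form: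
  "n \<le> N \<Longrightarrow> jtp_coeff N n * qpoch 1 (N - n) * qpoch 1 (Suc (N + n)) =
    (- 1) ^ n * fps_X ^ triangle n * (qpoch 1 (Suc (2 * N)) :: 'a :: field fps)"
proof (induction N arbitrary: n)
  case (Suc N)
  let ?q = "qpoch (1 :: 'a)" and ?e = "jtp_coeff N :: nat \<Rightarrow> 'a fps"
  define M where "M = (- 1) ^ n * fps_X ^ triangle n * ?q (Suc (2 * N))"
  \<comment> \<open>All powers of q that occur are monomials in a = q^(N+1-n), m = q^n and q, so the
    recursion becomes a polynomial identity.\<close>
  define a where "a = (fps_X ^ (Suc N - n) :: 'a fps)"
  define m where "m = (fps_X ^ n :: 'a fps)"
  define h where "h = ?q (Suc N - n) * ?q (Suc (Suc N + n))"
  have Q: "fps_X ^ Suc N = a * m"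
    unfolding a_def m_def power_add[symmetric] using Suc.prems by simp
  have Xb: "fps_X ^ Suc (N + n) = a * m * m"
    unfolding Q[symmetric] by (simp add: m_def power_add)
  have Xc: "fps_X ^ Suc (Suc (N + n)) = a * m * m * fps_X"
    unfolding Xb[symmetric] by simp
  have high: "?q (Suc (Suc N + n)) = ?q (Suc (N + n)) * (1 - a * m * m * fps_X)"
    by (simp only: add_Suc qpoch_1_Suc[of "Suc (N + n)"] Xc)
  have same: "?e n * h = (1 - a) * (1 - a * m * m * fps_X) * M"
  proof (cases "n \<le> N")
    case True
    then have low: "?q (Suc N - n) = ?q (N - n) * (1 - a)"
      by (simp add: Suc_diff_le qpoch_1_Suc a_def del: power_Suc)
    have "?e n * h = (1 - a) * (1 - a * m * m * fps_X) * (?e n * ?q (N - n) * ?q (Suc (N + n)))"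
      unfolding h_def low high by (simp only: ac_simps)
    then show ?thesis
      unfolding Suc.IH[OF True] M_def .
  next
    \<comment> \<open>Here n = N + 1 and a = 1, so both sides vanish.\<close>
    case False
    with Suc.prems show ?thesis
      by (simp add: jtp_coeff_eq_0 a_def)
  qed
  have below: "m * reflected_pred ?e n * h = - ((1 - a * m * m) * (1 - a * m * m * fps_X) * M)"
  proof (cases n)
    case 0
    have "?e 0 * ?q N * ?q (Suc N) = ?q (Suc (2 * N))"
      using Suc.IH[of 0] by simp
    moreover have "?q (Suc N) = ?q N * (1 - a)"
      by (simp add: qpoch_1_Suc a_def 0 del: power_Suc)
    ultimately show ?thesis
      using high by (simp add: 0 reflected_pred_def h_def M_def m_def del: power_Suc)
        (simp add: mult.assoc)
  next
    case (Suc k)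
    have k: "k \<le> N" and diff: "Suc N - n = N - k"
      using Suc Suc.prems by auto
    have "?q (Suc (N + n)) = ?q (Suc (N + k)) * (1 - a * m * m)"
      using Xb by (simp add: Suc qpoch_1_Suc[of "Suc (N + k)"] del: power_Suc)
    then have h: "h = ?q (N - k) * (?q (Suc (N + k)) * (1 - a * m * m) * (1 - a * m * m * fps_X))"
      unfolding h_def high diff by simp
    have M: "M = - (m * ((- 1) ^ k * fps_X ^ triangle k * ?q (Suc (2 * N))))"
      by (simp add: M_def Suc m_def power_add ac_simps)
    have "m * reflected_pred ?e n * h = m * (?e k * ?q (N - k) * ?q (Suc (N + k))) *
        ((1 - a * m * m) * (1 - a * m * m * fps_X))"
      unfolding h by (simp add: reflected_pred_def Suc ac_simps)
    then show ?thesis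
      unfolding Suc.IH[OF k] M by (simp add: ac_simps)
  qed
  have above: "?e (Suc n) * h = - ((1 - a) * (fps_X - a) * m * M)"
  proof (cases "n < N")
    case True
    then obtain d where d: "N = Suc (n + d)"
      using less_iff_Suc_add by auto
    have e: "?e (Suc n) * ?q d * ?q (Suc (Suc N + n)) = - (m * fps_X * M)"
      using Suc.IH[of "Suc n"] True by (simp add: d M_def m_def power_add ac_simps)
    define b where "b = (fps_X ^ Suc d :: 'a fps)"
    have low: "?q (Suc N - n) = ?q d * (1 - b) * (1 - a)"
      by (simp add: d a_def b_def qpoch_1_Suc del: power_Suc)
    have "a = fps_X * b"
      by (simp add: d a_def b_def)
    then show ?thesis
      unfolding h_def using e low by algebra
  next
    \<comment> \<open>For n = N the factor q - a vanishes, for n = N + 1 the factor 1 - a.\<close>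
    case False
    with Suc.prems consider "n = N" | "n = Suc N"
      by linarith
    then show ?thesis
      by cases (simp_all add: jtp_coeff_eq_0 a_def)
  qed
  have top: "?q (Suc (2 * Suc N)) =
      ?q (Suc (2 * N)) * (1 - a * m * (a * m)) * (1 - a * m * (a * m) * fps_X)"
  proof -
    have P: "fps_X ^ Suc (Suc (2 * N)) = a * m * (a * m)"
      unfolding Q[symmetric] by (simp add: power_add[symmetric] mult_2 flip: power_Suc)
    have "2 * Suc N = Suc (Suc (2 * N))"
      by simp
    then have "?q (Suc (2 * Suc N)) =
        ?q (Suc (2 * N)) * (1 - a * m * (a * m)) * (1 - fps_X * (a * m * (a * m)))"
      by (simp only: qpoch_1_Suc[of "Suc (2 * N)"] qpoch_1_Suc[of "Suc (Suc (2 * N))"]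
          power_Suc[of _ "Suc (Suc (2 * N))"] P)
    then show ?thesis
      by (simp only: ac_simps)
  qed
  have "jtp_coeff (Suc N) n * ?q (Suc N - n) * ?q (Suc (Suc N + n)) = jtp_coeff (Suc N) n * h"
    unfolding h_def by (simp only: mult.assoc)
  also have "\<dots> = (1 + a * m * (a * m)) * (?e n * h) - a * (m * reflected_pred ?e n * h)
      - a * m * (?e (Suc n) * h)"
    unfolding jtp_coeff.simps Q by (simp only: algebra_simps)
  also have "\<dots> = (1 - a * m * (a * m)) * (1 - a * m * (a * m) * fps_X) * M"
    unfolding same below above by algebra
  also have "\<dots> = (- 1) ^ n * fps_X ^ triangle n * ?q (Suc (2 * Suc N))"
    unfolding top M_def by (simp only: ac_simps)
  finally show ?case .
qed simp

section \<open>Theta series from the finite triple product\<close>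

definition theta :: "nat \<Rightarrow> (nat \<Rightarrow> 'a :: field) \<Rightarrow> 'a fps"
  where "theta N v = (\<Sum>n\<le>N. fps_const ((- 1) ^ n * v n) * fps_X ^ triangle n)"

lemma le_triangle: "n \<le> triangle n"
  by (induction n) auto

text \<open>The four Pochhammer products around the closed form all agree with
  \<open>qpoch 1 (N - n)\<close> up to order N - n, so they cancel to that order. The factor
  \<open>fps_X ^ triangle n\<close> with triangle n \<ge> n raises the accuracy to N.\<close>

lemma qpoch_times_jtp_coeff:
  assumes "n \<le> N"
  shows "eq_upto N (qpoch 1 N * jtp_coeff N n) ((- 1) ^ n * fps_X ^ triangle n :: 'a :: field fps)"
proof -
  let ?q = "qpoch (1 :: 'a)"
  define h where "h = ?q (N - n) * ?q (Suc (N + n))"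
  have "eq_upto (N - n) (?q N * ?q (Suc (2 * N))) (?q (N - n) * ?q (N - n))"
    by (intro eq_upto_mult qpoch_eq_upto) auto
  moreover have "eq_upto (N - n) (?q (N - n) * ?q (N - n)) (?q (N - n) * ?q (Suc (N + n)))"
    by (intro eq_upto_mult eq_upto_refl eq_upto_sym[OF qpoch_eq_upto]) auto
  ultimately have "eq_upto (N - n + triangle n)
      (fps_X ^ triangle n * (?q N * ?q (Suc (2 * N)))) (fps_X ^ triangle n * h)"
    unfolding h_def by (intro eq_upto_X_power_mult) (rule eq_upto_trans)
  then have "eq_upto N (fps_X ^ triangle n * (?q N * ?q (Suc (2 * N)))) (fps_X ^ triangle n * h)"
    by (rule eq_upto_mono) (use assms le_triangle[of n] in linarith)
  then have "eq_upto N ((- 1) ^ n * (fps_X ^ triangle n * (?q N * ?q (Suc (2 * N)))))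
      ((- 1) ^ n * (fps_X ^ triangle n * h))"
    by (rule eq_upto_mult[OF eq_upto_refl])
  moreover have "(- 1) ^ n * (fps_X ^ triangle n * (?q N * ?q (Suc (2 * N)))) =
      h * (?q N * jtp_coeff N n)"
  proof -
    have "h * (?q N * jtp_coeff N n) =
        ?q N * (jtp_coeff N n * ?q (N - n) * ?q (Suc (N + n)))"
      unfolding h_def by (simp only: ac_simps)
    then show ?thesis
      unfolding jtp_coeff_closed_form[OF assms] by (simp only: ac_simps)
  qed
  moreover have "(- 1) ^ n * (fps_X ^ triangle n * h) = h * ((- 1) ^ n * fps_X ^ triangle n)"
    by (simp only: ac_simps)
  ultimately have "eq_upto N (h * (?q N * jtp_coeff N n)) (h * ((- 1) ^ n * fps_X ^ triangle n))"
    by (simp only:)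
  then show ?thesis
    by (rule eq_upto_cancel) (simp add: h_def)
qed

lemma qpoch_times_jtp_sum:
  "eq_upto N (qpoch 1 N * (\<Sum>n\<le>N. jtp_coeff N n * fps_const (v n))) (theta N v)"
proof -
  have "qpoch 1 N * (\<Sum>n\<le>N. jtp_coeff N n * fps_const (v n)) =
      (\<Sum>n\<le>N. qpoch 1 N * jtp_coeff N n * fps_const (v n))"
    by (simp add: sum_distrib_left mult.assoc)
  also have "eq_upto N \<dots> (\<Sum>n\<le>N. ((- 1) ^ n * fps_X ^ triangle n) * fps_const (v n))"
    by (intro eq_upto_sum eq_upto_mult eq_upto_refl qpoch_times_jtp_coeff) auto
  also have "\<dots> = theta N v"
  proof -
    have sign: "fps_const ((- 1) ^ n) = (- 1 :: 'a fps) ^ n" for n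
      by (cases "even n") simp_all
    show ?thesis
      unfolding theta_def fps_const_mult[symmetric] sign by (simp only: ac_simps)
  qed
  finally show ?thesis .
qed


subsection \<open>Fifth roots of unity\<close>

lemma mod_5_cases:
  fixes n :: nat
  obtains "n = 5 * (n div 5)" "n mod 5 = 0" | "n = 5 * (n div 5) + 1" "n mod 5 = 1"
    | "n = 5 * (n div 5) + 2" "n mod 5 = 2" | "n = 5 * (n div 5) + 3" "n mod 5 = 3"
    | "n = 5 * (n div 5) + 4" "n mod 5 = 4"
proof -
  have "n mod 5 < 5"
    by simp
  then consider "n mod 5 = 0" | "n mod 5 = 1" | "n mod 5 = 2" | "n mod 5 = 3" | "n mod 5 = 4"
    by linarith
  then show thesis
    by cases (use that mult_div_mod_eq[of 5 n] in simp_all)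
qed

lemma triangle_mod_5:
  "triangle n mod 5 = (if n mod 5 \<in> {0, 4} then 0 else if n mod 5 = 2 then 3 else 1)"
proof -
  have step: "triangle (m + 1) = triangle m + m + 1" "triangle (m + 2) = triangle m + 2 * m + 3"
    "triangle (m + 3) = triangle m + 3 * m + 6" "triangle (m + 4) = triangle m + 4 * m + 10"
    "triangle (m + 5) = triangle m + 5 * m + 15" for m
    by (simp_all add: eval_nat_numeral)
  have base: "triangle (5 * k) mod 5 = 0" for k
  proof (induction k)
    case (Suc k)
    have "triangle (5 * Suc k) = triangle (5 * k) + 5 * (5 * k) + 15"
      using step(5)[of "5 * k"] by (simp add: add.commute)
    with Suc show ?case
      by presburger
  qed simp
  define m where "m = 5 * (n div 5)"
  have m: "triangle m mod 5 = 0" "m mod 5 = 0"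
    unfolding m_def using base by auto
  show ?thesis
  proof (cases n rule: mod_5_cases)
    case 1
    with m show ?thesis by (simp add: m_def)
  next
    case 2
    then have "triangle n = triangle m + m + 1"
      using step(1)[of m] by (simp add: m_def)
    with 2 m show ?thesis by simp presburger
  next
    case 3
    then have "triangle n = triangle m + 2 * m + 3"
      using step(2)[of m] by (metis m_def)
    with 3 m show ?thesis by simp presburger
  next
    case 4
    then have "triangle n = triangle m + 3 * m + 6"
      using step(3)[of m] by (metis m_def)
    with 4 m show ?thesis by simp presburger
  next
    case 5
    then have "triangle n = triangle m + 4 * m + 10"
      using step(4)[of m] by (metis m_def)
    with 5 m show ?thesis by simp presburger
  qed
qed

lemma root_power_5:
  fixes z :: "'a :: field"
  assumes "1 + z + z ^ 2 + z ^ 3 + z ^ 4 = 0"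
  shows "z ^ 5 = 1"
proof -
  have "(z - 1) * (1 + z + z ^ 2 + z ^ 3 + z ^ 4) = z ^ 5 - 1"
    by (simp add: algebra_simps eval_nat_numeral)
  with assms show ?thesis
    by simp
qed

lemma root_power_mult_5:
  fixes z :: "'a :: field"
  assumes "1 + z + z ^ 2 + z ^ 3 + z ^ 4 = 0"
  shows "z ^ (5 * k) = 1" "(z ^ 4) ^ (5 * k) = 1"
proof -
  show *: "z ^ (5 * k) = 1"
    by (simp add: power_mult root_power_5[OF assms])
  have "(z ^ 4) ^ (5 * k) = (z ^ (5 * k)) ^ 4"
    by (simp only: power_mult[symmetric] mult.commute)
  with * show "(z ^ 4) ^ (5 * k) = 1"
    by simp
qed

lemma root_powers:
  fixes z :: "'a :: field"
  assumes "1 + z + z ^ 2 + z ^ 3 + z ^ 4 = 0"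
  shows "(z ^ 4) ^ 2 = z ^ 3" "(z ^ 4) ^ 3 = z ^ 2" "(z ^ 4) ^ 4 = z" "(z ^ 4) ^ 5 = 1"
    "(z ^ 2) ^ 2 = z ^ 4" "(z ^ 2) ^ 3 = z" "(z ^ 2) ^ 4 = z ^ 3"
proof -
  have *: "z ^ (5 * k + j) = z ^ j" for k j
    by (simp add: power_add root_power_mult_5[OF assms])
  show "(z ^ 4) ^ 2 = z ^ 3" "(z ^ 4) ^ 3 = z ^ 2" "(z ^ 4) ^ 4 = z" "(z ^ 4) ^ 5 = 1"
    "(z ^ 2) ^ 2 = z ^ 4" "(z ^ 2) ^ 3 = z" "(z ^ 2) ^ 4 = z ^ 3"
    using *[of 1 3] *[of 2 2] *[of 3 1] *[of 4 0] *[of 1 1] by (simp_all flip: power_mult)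
qed

lemma chi_add:
  fixes z x :: "'a :: field"
  assumes "z ^ m = 1" "x ^ m = 1"
  shows "chi z x (m + j) = chi z x m + (\<Sum>k = 1..j. z ^ k + x ^ k)"
  using assms by (induction j) (simp_all add: power_add)

lemma chi_deriv_add:
  fixes z x :: "'a :: field"
  assumes "z ^ m = 1" "x ^ m = 1"
  shows "chi_deriv z x (m + j) =
    chi_deriv z x m + (\<Sum>k = 1..j. (of_nat m + of_nat k) * (x ^ k - z ^ k))"
  using assms by (induction j) (simp_all add: power_add add.assoc[symmetric] add.commute[of 1])

text \<open>Here \<open>z ^ 4\<close> is 1/z. Over five consecutive exponents the powers of z sum to
  zero, so \<open>chi\<close> returns to its value after five steps.\<close>

lemma chi_block:
  fixes z :: "'a :: field"
  assumes root: "1 + z + z ^ 2 + z ^ 3 + z ^ 4 = 0" and m: "z ^ m = 1" "(z ^ 4) ^ m = 1"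
  shows "chi z (z ^ 4) (m + 1) = chi z (z ^ 4) m + (z + z ^ 4)"
    "chi z (z ^ 4) (m + 2) = chi z (z ^ 4) m + (z + z ^ 4) + (z ^ 2 + z ^ 3)"
    "chi z (z ^ 4) (m + 3) = chi z (z ^ 4) m + (z + z ^ 4) + 2 * (z ^ 2 + z ^ 3)"
    "chi z (z ^ 4) (m + 4) = chi z (z ^ 4) m + 2 * (z + z ^ 4) + 2 * (z ^ 2 + z ^ 3)"
    "chi z (z ^ 4) (m + 5) = chi z (z ^ 4) m"
proof -
  have sums: "sum f {1..1} = f 1" "sum f {1..2} = f 1 + f 2" "sum f {1..3} = f 1 + f 2 + f 3"
    "sum f {1..4} = f 1 + f 2 + f 3 + f 4" "sum f {1..5} = f 1 + f 2 + f 3 + f 4 + f 5"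
    for f :: "nat \<Rightarrow> 'a"
    by (simp_all add: eval_nat_numeral)
  note chi = chi_add[OF m] sums power_one_right root_powers[OF root] root_power_5[OF root]
  show "chi z (z ^ 4) (m + 1) = chi z (z ^ 4) m + (z + z ^ 4)"
    "chi z (z ^ 4) (m + 2) = chi z (z ^ 4) m + (z + z ^ 4) + (z ^ 2 + z ^ 3)"
    "chi z (z ^ 4) (m + 3) = chi z (z ^ 4) m + (z + z ^ 4) + 2 * (z ^ 2 + z ^ 3)"
    "chi z (z ^ 4) (m + 4) = chi z (z ^ 4) m + 2 * (z + z ^ 4) + 2 * (z ^ 2 + z ^ 3)"
    by (simp_all only: chi) (simp_all add: algebra_simps)
  have "chi z (z ^ 4) (m + 5) = chi z (z ^ 4) m + 2 * (1 + z + z ^ 2 + z ^ 3 + z ^ 4)"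
    by (simp only: chi) (simp add: algebra_simps)
  with root show "chi z (z ^ 4) (m + 5) = chi z (z ^ 4) m"
    by simp
qed

lemma chi_root:
  fixes z :: "'a :: field"
  assumes root: "1 + z + z ^ 2 + z ^ 3 + z ^ 4 = 0"
  shows "chi z (z ^ 4) n =
    (if n mod 5 = 0 then 1 else if n mod 5 = 1 then 1 + z + z ^ 4 else if n mod 5 = 2 then 0
     else if n mod 5 = 3 then - (1 + z + z ^ 4) else - 1)"
proof -
  note block = chi_block[OF root root_power_mult_5[OF root]]
  have base: "chi z (z ^ 4) (5 * k) = 1" for k
  proof (induction k)
    case (Suc k)
    have "5 * Suc k = 5 * k + 5"
      by simp
    with block(5)[of k] Suc show ?case
      by (simp only:)
  qed simp
  define c where "c = chi z (z ^ 4) n"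
  show ?thesis
  proof (cases n rule: mod_5_cases)
    case 1
    with base[of "n div 5"] show ?thesis by simp
  next
    case 2
    then have "c = 1 + (z + z ^ 4)"
      using block(1)[of "n div 5"] unfolding base c_def by simp
    with 2 show ?thesis by (simp add: c_def)
  next
    case 3
    then have "c = 1 + (z + z ^ 4) + (z ^ 2 + z ^ 3)"
      using block(2)[of "n div 5"] unfolding base c_def by metis
    then have "c = 0"
      using root by algebra
    with 3 show ?thesis by (simp add: c_def)
  next
    case 4
    then have "c = 1 + (z + z ^ 4) + 2 * (z ^ 2 + z ^ 3)"
      using block(3)[of "n div 5"] unfolding base c_def by metis
    then have "c = - (1 + z + z ^ 4)"
      using root by algebra
    with 4 show ?thesis by (simp add: c_def)
  next
    case 5
    then have "c = 1 + 2 * (z + z ^ 4) + 2 * (z ^ 2 + z ^ 3)"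
      using block(4)[of "n div 5"] unfolding base c_def by metis
    then have "c = - 1"
      using root by algebra
    with 5 show ?thesis by (simp add: c_def)
  qed
qed

lemma chi_deriv_block:
  fixes z :: "'a :: field"
  assumes root: "1 + z + z ^ 2 + z ^ 3 + z ^ 4 = 0" and m: "z ^ m = 1" "(z ^ 4) ^ m = 1"
  shows "chi_deriv z (z ^ 4) (m + 2) = chi_deriv z (z ^ 4) m + (of_nat m + 1) * (z ^ 4 - z)
      + (of_nat m + 2) * (z ^ 3 - z ^ 2)"
    "chi_deriv z (z ^ 4) (m + 5) = chi_deriv z (z ^ 4) m + 3 * (z - z ^ 4) + (z ^ 2 - z ^ 3)"
proof -
  have sums: "sum f {1..2} = f 1 + f 2" "sum f {1..5} = f 1 + f 2 + f 3 + f 4 + f 5"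
    for f :: "nat \<Rightarrow> 'a"
    by (simp_all add: eval_nat_numeral)
  note deriv = chi_deriv_add[OF m] sums power_one_right root_powers[OF root] root_power_5[OF root]
    of_nat_1 of_nat_numeral
  show "chi_deriv z (z ^ 4) (m + 2) = chi_deriv z (z ^ 4) m + (of_nat m + 1) * (z ^ 4 - z)
      + (of_nat m + 2) * (z ^ 3 - z ^ 2)"
    by (simp only: deriv) (simp only: add.assoc)
  show "chi_deriv z (z ^ 4) (m + 5) = chi_deriv z (z ^ 4) m + 3 * (z - z ^ 4) + (z ^ 2 - z ^ 3)"
    by (simp only: deriv) algebra
qed

text \<open>Unlike \<open>chi\<close>, its derivative grows by a fixed amount per block of five.
  Residue 2 is singled out because these are the indices whose triangular number is 3 modulo 5;
  there the linear growth factors as 2k + 1.\<close>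

lemma chi_deriv_root:
  fixes z :: "'a :: field"
  assumes root: "1 + z + z ^ 2 + z ^ 3 + z ^ 4 = 0" and n: "n mod 5 = 2"
  shows "chi_deriv z (z ^ 4) n = (2 * of_nat (n div 5) + 1) * (z ^ 4 - z + 2 * (z ^ 3 - z ^ 2))"
proof -
  note block = chi_deriv_block[OF root root_power_mult_5[OF root]]
  have base: "chi_deriv z (z ^ 4) (5 * k) = of_nat k * (3 * (z - z ^ 4) + (z ^ 2 - z ^ 3))" for k
  proof (induction k)
    case (Suc k)
    have "5 * Suc k = 5 * k + 5"
      by simp
    then have "chi_deriv z (z ^ 4) (5 * Suc k) =
        chi_deriv z (z ^ 4) (5 * k) + 3 * (z - z ^ 4) + (z ^ 2 - z ^ 3)"
      using block(2)[of k] by (simp only:)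
    then show ?case
      unfolding Suc by (simp add: distrib_right)
  qed simp
  define k where "k = (of_nat (n div 5) :: 'a)"
  have "n = 5 * (n div 5) + 2"
    using n by presburger
  then have "chi_deriv z (z ^ 4) n = k * (3 * (z - z ^ 4) + (z ^ 2 - z ^ 3))
      + (5 * k + 1) * (z ^ 4 - z) + (5 * k + 2) * (z ^ 3 - z ^ 2)"
    using block(1)[of "n div 5"] unfolding base k_def by (metis of_nat_mult of_nat_numeral)
  also have "\<dots> = (2 * k + 1) * (z ^ 4 - z + 2 * (z ^ 3 - z ^ 2))"
    by algebra
  finally show ?thesis
    unfolding k_def .
qed

text \<open>Squaring permutes the four powers z, z^2, z^3, z^4.\<close>

lemma root_square:
  fixes z :: "'a :: field"
  assumes root: "1 + z + z ^ 2 + z ^ 3 + z ^ 4 = 0"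
  shows "1 + z ^ 2 + (z ^ 2) ^ 2 + (z ^ 2) ^ 3 + (z ^ 2) ^ 4 = 0"
  using root unfolding root_powers[OF root] by (simp add: algebra_simps)

section \<open>The crank difference at fifth roots of unity as a theta product\<close>

lemma qpoch_5_roots:
  fixes z :: "'a :: field"
  assumes root: "1 + z + z ^ 2 + z ^ 3 + z ^ 4 = 0"
  shows "qpoch 1 N * (qpoch z N * qpoch (z ^ 4) N) * (qpoch (z ^ 2) N * qpoch (z ^ 3) N) =
    qpoch 1 N oo fps_X ^ 5"
proof -
  have "qpoch 1 N oo fps_X ^ 5 = (\<Prod>k = 1..N. (1 - fps_X ^ k) oo (fps_X ^ 5 :: 'a fps))"
    unfolding qpoch_def by (subst fps_compose_prod_distrib) auto
  also have "\<dots> = (\<Prod>k = 1..N. 1 - (fps_X ^ k) ^ 5)"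
    by (intro prod.cong refl)
       (simp add: fps_compose_sub_distrib fps_X_power_compose power_mult[symmetric] mult.commute)
  also have "\<dots> = (\<Prod>k = 1..N. (1 - fps_const 1 * fps_X ^ k) *
      ((1 - fps_const z * fps_X ^ k) * (1 - fps_const (z ^ 4) * fps_X ^ k)) *
      ((1 - fps_const (z ^ 2) * fps_X ^ k) * (1 - fps_const (z ^ 3) * fps_X ^ k)))"
  proof (intro prod.cong refl)
    fix k
    define t where "t = (fps_X ^ k :: 'a fps)"
    define Z where "Z = fps_const z"
    have "1 + Z + Z ^ 2 + Z ^ 3 + Z ^ 4 = fps_const (1 + z + z ^ 2 + z ^ 3 + z ^ 4)"
      by (simp add: Z_def fps_const_power)
    then have Z: "1 + Z + Z ^ 2 + Z ^ 3 + Z ^ 4 = 0"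
      using root by simp
    \<comment> \<open>The polynomial 1 - t^5 splits into the factors 1 - z^j t for j = 0, ...,
      4.\<close>
    have "1 - t ^ 5 = (1 - t) * ((1 - Z * t) * (1 - Z ^ 4 * t)) * ((1 - Z ^ 2 * t) * (1 - Z ^ 3 * t))"
      using Z by algebra
    then show "1 - (fps_X ^ k) ^ 5 = (1 - fps_const 1 * fps_X ^ k) *
      ((1 - fps_const z * fps_X ^ k) * (1 - fps_const (z ^ 4) * fps_X ^ k)) *
      ((1 - fps_const (z ^ 2) * fps_X ^ k) * (1 - fps_const (z ^ 3) * fps_X ^ k))"
      by (simp add: t_def Z_def fps_const_power)
  qed
  also have "\<dots> = qpoch 1 N * (qpoch z N * qpoch (z ^ 4) N) * (qpoch (z ^ 2) N * qpoch (z ^ 3) N)"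
    unfolding qpoch_def by (simp only: prod.distrib)
  finally show ?thesis ..
qed

text \<open>By \<open>qpoch_5_roots\<close> the squared factor is (E B B')^2. One B is absorbed by
  \<open>crank_gf_diff\<close>, which leaves E (-L). Of the resulting three factors E, one joins B L
  to form the differentiated theta series, and the other two join the two factors B'.\<close>

lemma crank_gf_diff_theta:
  fixes z :: "'a :: field"
  assumes root: "1 + z + z ^ 2 + z ^ 3 + z ^ 4 = 0"
  shows "eq_upto N ((qpoch 1 N oo fps_X ^ 5) ^ 2 * (crank_gf N z - crank_gf N (z ^ 4)))
    (- (theta N (chi_deriv z (z ^ 4)) * theta N (chi (z ^ 2) (z ^ 3)) ^ 2))"
proof -
  define E where "E = (qpoch 1 N :: 'a fps)"
  define B where "B = qpoch z N * qpoch (z ^ 4) N"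
  define B' where "B' = qpoch (z ^ 2) N * qpoch (z ^ 3) N"
  define D where "D = crank_gf N z - crank_gf N (z ^ 4)"
  define L where "L = lambert z N - lambert (z ^ 4) N"
  have "z * z ^ 4 = 1"
    using root_power_5[OF root] by (simp add: eval_nat_numeral)
  then have diff: "eq_upto N (B * D) (E * (- L))"
    and deriv: "B * L = (\<Sum>n\<le>N. jtp_coeff N n * fps_const (chi_deriv z (z ^ 4) n))"
    using crank_gf_diff[of z "z ^ 4" N] finite_triple_product_deriv[of z "z ^ 4" N]
    unfolding B_def D_def E_def L_def by simp_all
  have "z ^ 2 * z ^ 3 = 1"
    using root_power_5[OF root] by (simp add: power_add[symmetric])
  then have triple: "B' = (\<Sum>n\<le>N. jtp_coeff N n * fps_const (chi (z ^ 2) (z ^ 3) n))"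
    unfolding B'_def by (rule finite_triple_product)
  have "(qpoch 1 N oo fps_X ^ 5) ^ 2 * D = E ^ 2 * B'^2 * B * (B * D)"
    unfolding qpoch_5_roots[OF root, symmetric]
    unfolding E_def[symmetric] B_def[symmetric] B'_def[symmetric]
    by algebra
  also have "eq_upto N \<dots> (E ^ 2 * B'^2 * B * (E * (- L)))"
    by (rule eq_upto_mult[OF eq_upto_refl diff])
  also have "\<dots> = (- 1) * ((E * (B * L)) * ((E * B') * (E * B')))"
    by algebra
  also have "eq_upto N \<dots> ((- 1) * (theta N (chi_deriv z (z ^ 4)) *
      (theta N (chi (z ^ 2) (z ^ 3)) * theta N (chi (z ^ 2) (z ^ 3)))))"
    unfolding deriv triple E_def
    by (intro eq_upto_mult[OF eq_upto_refl] eq_upto_mult[OF _ eq_upto_mult] qpoch_times_jtp_sum)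
  finally show ?thesis
    by (simp add: D_def power2_eq_square)
qed

section \<open>Coefficients in the residue class 4 modulo 5\<close>

definition chi_sign :: "nat \<Rightarrow> 'a :: field"
  where "chi_sign n = (if n mod 5 < 2 then 1 else if n mod 5 = 2 then 0 else - 1)"

definition residue_coeff :: "nat \<Rightarrow> nat \<Rightarrow> nat \<Rightarrow> 'a :: field"
  where "residue_coeff a b c =
    (if a mod 5 = 2 then (2 * of_nat (a div 5) + 1) * (chi_sign b * chi_sign c) * - 5 else 0)"

text \<open>Triangular numbers are 0, 1 or 3 modulo 5, and \<open>chi\<close> at a primitive fifth root of unity
  vanishes at the indices whose triangular number is 3. So a sum of three of them that is 4 modulo 5
  contributes only if the first one has residue 3 and the others have residues 0 and 1.\<close>

lemma chi_product_residue:
  fixes z :: "'a :: field"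
  assumes root: "1 + z + z ^ 2 + z ^ 3 + z ^ 4 = 0"
    and "(triangle a + triangle b + triangle c) mod 5 = 4"
  shows "chi_deriv z (z ^ 4) a * (chi (z ^ 2) (z ^ 3) b * chi (z ^ 2) (z ^ 3) c) * (z ^ 3 - z ^ 2) =
    residue_coeff a b c * (1 + z ^ 2 + z ^ 3)"
proof -
  \<comment> \<open>\<open>chi_sign\<close> is the part of the value that does not depend on
    z.\<close>
  have chi: "chi (z ^ 2) (z ^ 3) n =
      chi_sign n * (if triangle n mod 5 = 1 then 1 + z ^ 2 + z ^ 3 else 1)" for n
    using chi_root[OF root_square[OF root], of n]
    unfolding root_powers(7)[OF root] triangle_mod_5 chi_sign_def
    by (cases n rule: mod_5_cases) simp_all
  have sum: "(triangle a mod 5 + triangle b mod 5 + triangle c mod 5) mod 5 = 4"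
  proof -
    have "(i mod 5 + j mod 5 + k mod 5) mod 5 = (i + j + k) mod 5" for i j k :: nat
      by (intro mod_add_cong) simp_all
    with assms(2) show ?thesis
      by (simp only:)
  qed
  have sign: "chi_sign n = (0 :: 'a)" if "n mod 5 = 2" for n
    using that by (simp add: chi_sign_def)
  show ?thesis
  proof (cases "a mod 5 = 2")
    case True
    define s where "s = chi_sign b * (chi_sign c :: 'a)"
    \<comment> \<open>The triangular numbers of b and c must add up to 1 modulo 5. Besides 0 + 1
      this allows 3 + 3, where both signs are 0.\<close>
    have tri: "s = 0 \<or> triangle b mod 5 = 0 \<and> triangle c mod 5 = 1 \<or>
        triangle b mod 5 = 1 \<and> triangle c mod 5 = 0"
      using sum True sign unfolding triangle_mod_5 s_def by (auto split: if_splits)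
    then have "chi (z ^ 2) (z ^ 3) b * chi (z ^ 2) (z ^ 3) c = s * (1 + z ^ 2 + z ^ 3)"
      unfolding chi s_def by auto
    then have "chi_deriv z (z ^ 4) a * (chi (z ^ 2) (z ^ 3) b * chi (z ^ 2) (z ^ 3) c) * (z ^ 3 - z ^ 2) =
        (2 * of_nat (a div 5) + 1) * s * (1 + z ^ 2 + z ^ 3) *
        ((z ^ 4 - z + 2 * (z ^ 3 - z ^ 2)) * (z ^ 3 - z ^ 2))"
      unfolding chi_deriv_root[OF root True] by (simp only: ac_simps)
    \<comment> \<open>This explains the multiplier z^3 - z^2: it turns the antisymmetric factor of
      \<open>chi_deriv\<close> into a constant.\<close>
    also have "(z ^ 4 - z + 2 * (z ^ 3 - z ^ 2)) * (z ^ 3 - z ^ 2) = - 5"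
      using root by algebra
    finally show ?thesis
      by (simp only: residue_coeff_def True s_def refl if_True ac_simps)
  next
    case False
    \<comment> \<open>Three residues from 0 and 1 add up to at most 3, so b or c must contribute a
      residue 3.\<close>
    then have "b mod 5 = 2 \<or> c mod 5 = 2"
      using sum unfolding triangle_mod_5 by (auto split: if_splits)
    with False show ?thesis
      unfolding chi residue_coeff_def using sign by auto
  qed
qed

lemma theta_product_nth:
  "fps_nth (theta N u * theta N v ^ 2) K =
    (\<Sum>a\<le>N. \<Sum>b\<le>N. \<Sum>c\<le>N. if triangle a + triangle b + triangle c = K
      then (- 1) ^ (a + b + c) * (u a * (v b * v c)) else 0)"
proof -
  define t where "t v n = fps_const ((- 1) ^ n * v n) * (fps_X ^ triangle n :: 'a fps)" for v n
  have "theta N u * theta N v ^ 2 = (\<Sum>a\<le>N. t u a) * (\<Sum>b\<le>N. \<Sum>c\<le>N. t v b * t v c)"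
    unfolding theta_def t_def power2_eq_square sum_product ..
  also have "\<dots> = (\<Sum>a\<le>N. \<Sum>b\<le>N. \<Sum>c\<le>N. t u a * (t v b * t v c))"
    by (simp only: sum_distrib_right) (simp only: sum_distrib_left)
  also have "\<dots> = (\<Sum>a\<le>N. \<Sum>b\<le>N. \<Sum>c\<le>N.
      fps_const ((- 1) ^ (a + b + c) * (u a * (v b * v c))) *
      fps_X ^ (triangle a + triangle b + triangle c))"
    unfolding t_def by (intro sum.cong refl) (simp add: power_add ac_simps flip: fps_const_mult)
  finally have "theta N u * theta N v ^ 2 = \<dots>" .
  then show ?thesis
    by (auto simp: fps_sum_nth fps_X_power_nth intro!: sum.cong)
qed

text \<open>The factor \<open>qpoch 1 N oo fps_X ^ 5\<close> and its inverse are series in $q^5$, so only the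
  coefficients in the residue class 4 modulo 5 of the theta product enter. The coefficient
  \<open>crank_residue N\<close> does not depend on the root of unity.\<close>

definition crank_residue :: "nat \<Rightarrow> 'a :: field"
  where "crank_residue N = - (\<Sum>i = 0..N. fps_nth (inverse ((qpoch 1 N oo fps_X ^ 5) ^ 2)) i *
    (\<Sum>a\<le>N. \<Sum>b\<le>N. \<Sum>c\<le>N. if triangle a + triangle b + triangle c = N - i
      then (- 1) ^ (a + b + c) * residue_coeff a b c else 0))"

text \<open>Dividing \<open>crank_gf_diff_theta\<close> by its unit factor involves the theta
  product only at exponents N - i with 5 dividing i. These are 4 modulo 5, so
  \<open>chi_product_residue\<close> applies to every term.\<close>

lemma crank_sum_diff:
  fixes z :: "'a :: field"
  assumes root: "1 + z + z ^ 2 + z ^ 3 + z ^ 4 = 0" and N: "N mod 5 = 4"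
  shows "(crank_sum N z - crank_sum N (z ^ 4)) * (z ^ 3 - z ^ 2) =
    crank_residue N * (1 + z ^ 2 + z ^ 3)"
proof -
  define F where "F = (qpoch 1 N oo fps_X ^ 5 :: 'a fps) ^ 2"
  define T where "T = theta N (chi_deriv z (z ^ 4)) * theta N (chi (z ^ 2) (z ^ 3)) ^ 2"
  define D where "D = crank_gf N z - crank_gf N (z ^ 4)"
  have z: "z \<noteq> 0"
    using root by auto
  have F0: "fps_nth F 0 \<noteq> 0"
    by (simp add: F_def power2_eq_square)
  have inv: "F * inverse F = 1"
    using F0 by (rule inverse_mult_eq_1')
  have "F = qpoch 1 N ^ 2 oo fps_X ^ 5"
    by (simp add: F_def fps_compose_power)
  then have "inverse F = inverse (qpoch 1 N ^ 2) oo fps_X ^ 5"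
    by (simp add: fps_inverse_compose power2_eq_square)
  then have supp: "fps_nth (inverse F) i = 0" if "\<not> 5 dvd i" for i
    using that by (simp add: fps_nth_compose_X_power)
  have "eq_upto N (F * D) (F * (inverse F * (- T)))"
    using crank_gf_diff_theta[OF root, of N] inv
    by (simp add: F_def[symmetric] D_def[symmetric] T_def[symmetric] flip: mult.assoc)
  then have "eq_upto N D (inverse F * (- T))"
    by (rule eq_upto_cancel[OF _ F0])
  then have D: "fps_nth D N = - (\<Sum>i = 0..N. fps_nth (inverse F) i * fps_nth T (N - i))"
    by (simp add: eq_upto_def fps_mult_nth)
  have "fps_nth (inverse F) i * fps_nth T (N - i) * (z ^ 3 - z ^ 2) = fps_nth (inverse F) i *
    (\<Sum>a\<le>N. \<Sum>b\<le>N. \<Sum>c\<le>N. if triangle a + triangle b + triangle c = N - i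
      then (- 1) ^ (a + b + c) * residue_coeff a b c else 0) * (1 + z ^ 2 + z ^ 3)"
    if "i \<in> {0..N}" for i
  proof (cases "5 dvd i")
    case True
    then obtain k where "i = 5 * k"
      by (rule dvdE)
    moreover define d where "d = N - i"
    ultimately have "N = 5 * k + d"
      using that by simp
    then have *: "(N - i) mod 5 = 4"
      using N by (simp add: \<open>i = 5 * k\<close>)
    have "fps_nth T (N - i) * (z ^ 3 - z ^ 2) =
      (\<Sum>a\<le>N. \<Sum>b\<le>N. \<Sum>c\<le>N. if triangle a + triangle b + triangle c = N - i
        then (- 1) ^ (a + b + c) * residue_coeff a b c else 0) * (1 + z ^ 2 + z ^ 3)"
      unfolding T_def theta_product_nth sum_distrib_right
    proof (intro sum.cong refl)
      fix a b c
      show "(if triangle a + triangle b + triangle c = N - i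
          then (- 1) ^ (a + b + c) * (chi_deriv z (z ^ 4) a *
            (chi (z ^ 2) (z ^ 3) b * chi (z ^ 2) (z ^ 3) c)) else 0) * (z ^ 3 - z ^ 2) =
        (if triangle a + triangle b + triangle c = N - i
          then (- 1) ^ (a + b + c) * residue_coeff a b c else 0) * (1 + z ^ 2 + z ^ 3)"
        using chi_product_residue[OF root, of a b c] * by (simp add: mult.assoc)
    qed
    then show ?thesis
      by (simp only: mult.assoc)
  qed (simp add: supp)
  then have "fps_nth D N * (z ^ 3 - z ^ 2) = crank_residue N * (1 + z ^ 2 + z ^ 3)"
    unfolding D crank_residue_def F_def[symmetric] sum_distrib_right minus_mult_left[symmetric]
    by (intro arg_cong[where f = uminus] sum.cong refl) auto
  then show ?thesis
    using z by (simp add: D_def crank_gf_nth)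
qed

subsection \<open>The linear relation between crank classes\<close>

text \<open>As z^5 = 1, the power of z depends only on the crank modulo 5, and partitions can be
  grouped by that residue.\<close>

lemma crank_sum_eq_M_omega:
  fixes z :: "'a :: field"
  assumes "z ^ 5 = 1"
  shows "crank_sum N z = (\<Sum>m\<in>{0, 1, 2, 3, 4}. of_int (M_omega (int m) 5 N) * z ^ m)"
proof -
  have "z \<noteq> 0"
    using assms by auto
  have powi: "z powi c = z ^ nat (c mod 5)" for c
  proof -
    have "z powi c = z powi (5 * (c div 5) + c mod 5)"
      by simp
    also have "\<dots> = z powi (5 * (c div 5)) * z powi (c mod 5)"
      using \<open>z \<noteq> 0\<close> by (intro power_int_add) simp
    also have "z powi (5 * (c div 5)) = (z powi 5) powi (c div 5)"
      by (rule power_int_mult)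
    finally show ?thesis
      using assms by (simp add: power_int_def)
  qed
  define f where "f \<pi> = of_nat (num_ones \<pi>) * z powi crank \<pi>" for \<pi>
  have res: "nat (crank \<pi> mod 5) = m \<longleftrightarrow> [crank \<pi> = int m] (mod 5)" if "m < 5" for \<pi> m
    using that unfolding cong_def by auto
  have "nat (c mod 5) \<in> {0, 1, 2, 3, 4}" for c :: int
    by auto
  then have "crank_sum N z = (\<Sum>m\<in>{0, 1, 2, 3, 4}. \<Sum>\<pi> | \<pi> \<in> {\<pi>. \<pi> \<turnstile> N} \<and> nat (crank \<pi> mod 5) = m. f \<pi>)"
    unfolding crank_sum_def f_def[symmetric]
    by (intro sum.group[symmetric] finite_partitions) auto
  also have "\<dots> = (\<Sum>m\<in>{0, 1, 2, 3, 4}. of_int (M_omega (int m) 5 N) * z ^ m)"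
  proof (intro sum.cong refl)
    fix m :: nat assume "m \<in> {0, 1, 2, 3, 4}"
    then have m: "m < 5"
      by auto
    show "(\<Sum>\<pi> | \<pi> \<in> {\<pi>. \<pi> \<turnstile> N} \<and> nat (crank \<pi> mod 5) = m. f \<pi>) = of_int (M_omega (int m) 5 N) * z ^ m"
      unfolding M_omega_def of_int_sum sum_distrib_right
      by (intro sum.cong) (auto simp: res[OF m] f_def powi dest: res[OF m, THEN iffD2])
  qed
  finally show ?thesis .
qed


theorem theorem1p2:
  fixes n :: nat
  shows "M_omega 1 5 (5 * n + 4) - M_omega 4 5 (5 * n + 4)
       = 2 * M_omega 3 5 (5 * n + 4) - 2 * M_omega 2 5 (5 * n + 4)"
proof -
  define N where "N = 5 * n + 4"
  have N: "N mod 5 = 4"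
    by (simp add: N_def)
  define M where "M m = (of_int (M_omega m 5 N) :: complex)" for m
  define \<alpha> where "\<alpha> = M 1 - M 4"
  define \<beta> where "\<beta> = M 2 - M 3"
  define \<rho> where "\<rho> = (crank_residue N :: complex)"
  \<comment> \<open>The coefficients are the same for every such z, so different values of z + z^4
    can be compared.\<close>
  have rel: "(2 * \<alpha> - \<beta> + \<rho>) * (z + z ^ 4) + (\<alpha> + 2 * \<beta>) = 0"
    if root: "1 + z + z ^ 2 + z ^ 3 + z ^ 4 = 0" for z :: complex
  proof -
    have "crank_sum N z = M 0 + M 1 * z + M 2 * z ^ 2 + M 3 * z ^ 3 + M 4 * z ^ 4"
      by (simp add: crank_sum_eq_M_omega root_power_5[OF root] M_def)
    moreover have "z ^ 8 = z ^ 3" "z ^ 12 = z ^ 2" "z ^ 16 = z"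
      using root_powers(1-3)[OF root] by simp_all
    then have "crank_sum N (z ^ 4) = M 0 + M 1 * z ^ 4 + M 2 * z ^ 3 + M 3 * z ^ 2 + M 4 * z"
      unfolding crank_sum_eq_M_omega[OF root_powers(4)[OF root]]
      by (simp add: M_def)
    ultimately have "crank_sum N z - crank_sum N (z ^ 4) = \<alpha> * (z - z ^ 4) + \<beta> * (z ^ 2 - z ^ 3)"
      unfolding \<alpha>_def \<beta>_def by algebra
    with crank_sum_diff[OF root N]
    have "(\<alpha> * (z - z ^ 4) + \<beta> * (z ^ 2 - z ^ 3)) * (z ^ 3 - z ^ 2) = \<rho> * (1 + z ^ 2 + z ^ 3)"
      by (simp only: \<rho>_def)
    moreover have "(z - z ^ 4) * (z ^ 3 - z ^ 2) = 1 + 2 * (z + z ^ 4)"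
      "(z ^ 2 - z ^ 3) * (z ^ 3 - z ^ 2) = 2 - (z + z ^ 4)" "1 + z ^ 2 + z ^ 3 = - (z + z ^ 4)"
      using root by algebra+
    ultimately have "\<alpha> * (1 + 2 * (z + z ^ 4)) + \<beta> * (2 - (z + z ^ 4)) = \<rho> * - (z + z ^ 4)"
      by (simp only: distrib_right mult.assoc)
    then show ?thesis
      by algebra
  qed
  define z where "z = cis (2 * pi / 5)"
  have "z ^ 5 = 1"
    by (simp add: z_def DeMoivre)
  moreover have "z \<noteq> 1"
  proof
    assume "z = 1"
    then have "cos (2 * pi / 5) = cos 0"
      by (simp add: z_def cis.ctr complex_eq_iff)
    then show False
      using cos_inj_pi[of "2 * pi / 5" 0] by simp
  qed
  moreover have "(z - 1) * (1 + z + z ^ 2 + z ^ 3 + z ^ 4) = z ^ 5 - 1"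
    by algebra
  ultimately have root: "1 + z + z ^ 2 + z ^ 3 + z ^ 4 = 0"
    by simp
  \<comment> \<open>The square of the difference of the two sides is 5.\<close>
  have "z + z ^ 4 \<noteq> z ^ 2 + z ^ 3"
  proof
    assume "z + z ^ 4 = z ^ 2 + z ^ 3"
    with root have "(5 :: complex) = 0"
      by algebra
    then show False by simp
  qed
  \<comment> \<open>Subtracting the relation for z^2 from the one for z removes the constant term;
    as the two sums differ, the linear coefficient is zero.\<close>
  moreover have "(2 * \<alpha> - \<beta> + \<rho>) * (z + z ^ 4 - (z ^ 2 + z ^ 3)) = 0"
    using rel[OF root] rel[OF root_square[OF root]] 
    unfolding root_powers[OF root] by algebra
  ultimately have "\<alpha> + 2 * \<beta> = 0"
    using rel[OF root] by simp
  then have "(of_int (M_omega 1 5 N - M_omega 4 5 N) :: complex) =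
      of_int (2 * M_omega 3 5 N - 2 * M_omega 2 5 N)"
    by (simp add: \<alpha>_def \<beta>_def M_def algebra_simps eq_neg_iff_add_eq_0)
  then show ?thesis
    unfolding of_int_eq_iff N_def .
qed

end
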